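(* Assume that $(Z, d_Z, \nu_Z)$ and $(W, d_W, \nu_W)$ are Ahlfors $Q_Z$-regular and Ahlfors $Q_W$-regular spaces with $Q_Z>0$ and $Q_W>0$, respectively, and let $\theta_1>0$, $\theta_2>0$, $s>0$, $s'>0$ and $p\geq 1$ be constants such that $$Q_Z\geq \theta_1 Q_W\quad\text{and}\quad s'\leq \theta_2 s+\frac{\theta_2 Q_W-Q_Z}{p}.$$ Suppose that $f: (Z, d_Z)\rightarrow (W, d_W)$ is a locally $(\theta_1, \theta_2, r)$-biHölder continuous mapping with $0<r<2\,\mathrm{diam}\, Z$. Then $f$ induces a canonical bounded embedding $f_{\#}: B^{s}_{p,p}(W)\rightarrow B^{s'}_{p,p}(Z)$ via composition, $f_{\#}(u)=u\circ f$; that is, $u\mapsto u\circ f$ is well defined from $B^s_{p,p}(W)$ to $B^{s'}_{p,p}(Z)$ and there is a constant $C$, independent of $u$, such that $\|u\circ f\|_{B^{s'}_{p,p}(Z)}\leq C\|u\|_{B^{s}_{p,p}(W)}$ for all $u\in B^s_{p,p}(W)$.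
   Context: All metric spaces contain at least two points. $\mathrm{diam}\, Z=\sup\{d_Z(z_1,z_2): z_1,z_2\in Z\}$, with $\mathrm{diam}\, Z=\infty$ if $Z$ is unbounded. $B(x,r)=\{y\in Z: d_Z(y,x)<r\}$ denotes the open ball. $(Z,d_Z,\nu_Z)$ denotes a metric space $(Z,d_Z)$ equipped with a Borel regular measure $\nu_Z$ (similarly for $W$). Ahlfors regularity: $(Z,d_Z,\nu_Z)$ is Ahlfors $Q_Z$-regular ($Q_Z>0$) if there is a constant $C\geq 1$ such that for all $z\in Z$ and $0<\rho<2\,\mathrm{diam}\, Z$, $C^{-1}\rho^{Q_Z}\leq \nu_Z(B(z,\rho))\leq C\rho^{Q_Z}$. Locally biHölder maps: for $\theta_1>0$, $\theta_2>0$ and $0<r<2\,\mathrm{diam}\, Z$, a homeomorphism $f:(Z,d_Z)\to(W,d_W)$ (onto $W$) is locally $(\theta_1,\theta_2,r)$-biHölder continuous if there is a constant $C\geq 1$ such that $C^{-1}d_Z(x,y)^{\theta_1}\leq d_W(f(x),f(y))\leq C d_Z(x,y)^{\theta_2}$ for all $x,y\in Z$ with $d_Z(x,y)<r$. Besov spaces: for $1\leq p<\infty$, $s>0$ and $u:Z\to\mathbb{R}$, set $$\|u\|_{\dot B^s_{p,p}(Z)}=\left(\int_Z\int_Z \frac{|u(x)-u(y)|^p}{d_Z(x,y)^{sp}}\,\frac{d\nu_Z(x)\,d\nu_Z(y)}{\nu_Z(B(x,d_Z(x,y)))}\right)^{1/p}.$$ $B^s_{p,p}(Z)$ is the normed space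 of all measurable functions $u\in L^p(Z)$ with $\|u\|_{B^s_{p,p}(Z)}=\|u\|_{L^p(Z)}+\|u\|_{\dot B^s_{p,p}(Z)}<\infty$ (functions being identified when they agree almost everywhere). The space $B^s_{p,p}(W)$ is defined analogously. *)

theory Defs
  imports "HOL-Analysis.Analysis"
begin

text \<open>The library's \<open>diameter\<close> is real-valued and is 0 for unbounded sets; here the diameter of an
  unbounded space has to be infinite.\<close>

definition ediam :: "'a::metric_space set \<Rightarrow> ennreal" where
  "ediam S = (SUP x\<in>S. SUP y\<in>S. ennreal (dist x y))"

text \<open>A Borel regular (outer) measure is represented by its restriction to a complete
  sigma-algebra of measurable sets: all Borel sets are measurable, and every measurable set has a
  Borel hull of the same measure. Completeness makes ``measurable'' invariant under modification
  on null sets, as for the Caratheodory-measurable sets of an outer measure.\<close>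

definition borel_regular :: "'a::topological_space measure \<Rightarrow> bool" where
  "borel_regular M \<longleftrightarrow>
     space M = UNIV \<and> sets borel \<subseteq> sets M \<and>
     (\<forall>N\<in>null_sets M. \<forall>A\<subseteq>N. A \<in> sets M) \<and>
     (\<forall>A\<in>sets M. \<exists>B\<in>sets borel. A \<subseteq> B \<and> emeasure M B = emeasure M A)"

definition ahlfors_regular :: "'a::metric_space measure \<Rightarrow> real \<Rightarrow> bool" where
  "ahlfors_regular M Q \<longleftrightarrow>
     (\<exists>C\<ge>1. \<forall>z \<rho>. 0 < \<rho> \<and> ennreal \<rho> < 2 * ediam (UNIV :: 'a set) \<longrightarrow>
        ennreal (inverse C * \<rho> powr Q) \<le> emeasure M (ball z \<rho>) \<and>
        emeasure M (ball z \<rho>) \<le> ennreal (C * \<rho> powr Q))"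

definition locally_biHolder ::
  "real \<Rightarrow> real \<Rightarrow> real \<Rightarrow> ('a::metric_space \<Rightarrow> 'b::metric_space) \<Rightarrow> bool" where
  "locally_biHolder \<theta>1 \<theta>2 r f \<longleftrightarrow>
     (\<exists>g. homeomorphism UNIV UNIV f g) \<and>
     (\<exists>C\<ge>1. \<forall>x y. dist x y < r \<longrightarrow>
        inverse C * dist x y powr \<theta>1 \<le> dist (f x) (f y) \<and>
        dist (f x) (f y) \<le> C * dist x y powr \<theta>2)"

text \<open>Real powers of extended nonnegative numbers, meant for positive exponents.\<close>

definition epowr :: "ennreal \<Rightarrow> real \<Rightarrow> ennreal" where
  "epowr x a = (if x = \<infinity> then \<infinity> else ennreal (enn2real x powr a))"

definition Lp_norm :: "'a measure \<Rightarrow> real \<Rightarrow> ('a \<Rightarrow> real) \<Rightarrow> ennreal" where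
  "Lp_norm M p u = epowr (\<integral>\<^sup>+x. ennreal (\<bar>u x\<bar> powr p) \<partial>M) (1 / p)"

text \<open>On the diagonal the integrand below is 0, by the conventions for division by 0.\<close>

definition besov_seminorm ::
  "'a::metric_space measure \<Rightarrow> real \<Rightarrow> real \<Rightarrow> ('a \<Rightarrow> real) \<Rightarrow> ennreal" where
  "besov_seminorm M s p u =
     epowr (\<integral>\<^sup>+y. (\<integral>\<^sup>+x. ennreal (\<bar>u x - u y\<bar> powr p / dist x y powr (s * p))
                            / emeasure M (ball x (dist x y)) \<partial>M) \<partial>M) (1 / p)"

definition besov_norm ::
  "'a::metric_space measure \<Rightarrow> real \<Rightarrow> real \<Rightarrow> ('a \<Rightarrow> real) \<Rightarrow> ennreal" where
  "besov_norm M s p u = Lp_norm M p u + besov_seminorm M s p u"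

text \<open>The functions representing elements of the Besov space; the space itself consists of their
  classes modulo equality almost everywhere.\<close>

definition besov_space ::
  "'a::metric_space measure \<Rightarrow> real \<Rightarrow> real \<Rightarrow> ('a \<Rightarrow> real) set" where
  "besov_space M s p =
     {u \<in> borel_measurable M. Lp_norm M p u < \<infinity> \<and> besov_norm M s p u < \<infinity>}"

end

theory Submission
  imports Defs
begin

text \<open>Composition with \<open>f\<close> is bounded because \<open>f\<close> neither shrinks measure nor expands distance too
  much, both in a quantitative sense.

  The lower Hoelder bound says that the inverse of \<open>f\<close> is locally Hoelder with exponent
  \<open>1 / \<theta>1\<close>, so it maps a small ball of radius \<open>\<rho>\<close> into a ball of radius comparable to
  \<open>\<rho> powr (1 / \<theta>1)\<close>, whose measure is at most a constant times \<open>\<rho> powr (QZ / \<theta>1)\<close>. As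
  \<open>QZ / \<theta>1 \<ge> QW\<close>, this is at most a constant times the measure of the original ball. Covering
  the sets of an exhaustion of an open set \<open>U\<close>, each by balls of a fixed small scale, gives
  \<open>\<nu>Z (f -` U) \<le> K * \<nu>W U\<close>
  (\<open>open_preimage_measure_bound\<close>), regularity extends this to all measurable sets
  (\<open>preimage_measure_bound\<close>), and thus \<open>\<integral>h \<circ> f d\<nu>Z \<le> K * \<integral>h d\<nu>W\<close> for every nonnegative
  measurable \<open>h\<close> (\<open>nn_integral_comp_le\<close>). With \<open>h = |u|\<close> to the power \<open>p\<close> this bounds the norm of
  \<open>u \<circ> f\<close> in \<open>L\<^sup>p\<close>, and with indicators of null sets it shows that the operator respects equality
  almost everywhere.

  By Ahlfors regularity the weight in the Besov seminorm is comparable to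
  \<open>dist x y powr - (s' * p + QZ)\<close>. For \<open>dist x y < r\<close> the upper Hoelder bound and the condition
  on \<open>s'\<close> give \<open>dist x y powr - (s' * p + QZ) \<le> c * dist (f x) (f y) powr - (s * p + QW)\<close>
  (\<open>gagliardo_kernel_comp_le\<close>), so the near part of the double integral is bounded by the
  seminorm of \<open>u\<close> after two applications of the change of variables. For \<open>dist x y \<ge> r\<close> the
  difference is estimated by its two terms, and the truncated weight has bounded integrals
  (\<open>tail_bound\<close>, \<open>far_interaction_bound\<close>), which leaves the norm of \<open>u \<circ> f\<close> in \<open>L\<^sup>p\<close>.

  The metric spaces are arbitrary, so the separability behind Tonelli's theorem and the outer
  regularity of the measures have to be derived. The first follows from Ahlfors regularity
  (\<open>countable_dense\<close>, \<open>dist_measurable\<close>); the second holds for all Borel measures on metric spaces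
  that are finite on an exhausting sequence of open sets.\<close>

section \<open>Regularity of Borel measures on metric spaces\<close>

lemma decseq_emeasure_less:
  assumes B: "range B \<subseteq> sets N" "decseq B" and fin: "\<And>n::nat. emeasure N (B n) < \<infinity>"
    and less: "emeasure N (\<Inter>n. B n) < c"
  obtains n where "emeasure N (B n) < c"
proof -
  have "(\<lambda>n. emeasure N (B n)) \<longlonglongrightarrow> emeasure N (\<Inter>n. B n)"
    using B fin by (intro Lim_emeasure_decseq) (auto simp: less_top)
  from order_tendstoD(2)[OF this less] show ?thesis
    using that by (auto simp: eventually_sequentially)
qed

text \<open>In a metric space the points at distance at least \<open>1 / (n + 1)\<close> from the complement of an open set
  form closed sets that increase to it.\<close>

lemma open_approximable_from_inside:
  fixes N :: "'a::metric_space measure"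
  assumes borel: "sets borel \<subseteq> sets N" and G: "open G" "emeasure N G < \<infinity>"
    and A: "open A" and e: "0 < e"
  obtains F where "closed F" "F \<subseteq> A" "emeasure N (G \<inter> (A - F)) < ennreal e"
proof -
  \<comment> \<open>Written as the complement of a union of balls to make its closedness visible.\<close>
  define F where "F n = - (\<Union>y\<in>-A. ball y (inverse (real (Suc n))))" for n
  have closed: "closed (F n)" for n
    unfolding F_def by (intro closed_Compl open_UN ballI open_ball)
  have sub: "F n \<subseteq> A" for n
  proof
    fix x assume "x \<in> F n"
    moreover have "x \<in> ball x (inverse (real (Suc n)))" by simp
    ultimately show "x \<in> A" unfolding F_def by blast
  qed
  have "F m \<subseteq> F n" if "m \<le> n" for m n
  proof -
    have "inverse (real (Suc n)) \<le> inverse (real (Suc m))"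
      using that by (intro le_imp_inverse_le) auto
    then have "ball y (inverse (real (Suc n))) \<subseteq> ball y (inverse (real (Suc m)))" for y :: 'a
      by (rule subset_ball)
    then show ?thesis unfolding F_def by blast
  qed
  then have "incseq F" by (auto simp: incseq_def)
  have cover: "(\<Union>n. F n) = A"
  proof (rule equalityI[OF UN_least[OF sub]], rule subsetI)
    fix x assume "x \<in> A"
    then obtain d where d: "0 < d" "\<And>y. dist y x < d \<Longrightarrow> y \<in> A"
      using A by (auto simp: open_dist)
    obtain n where n: "inverse (real (Suc n)) < d"
      using reals_Archimedean[OF d(1)] by auto
    have "x \<in> F n"
      unfolding F_def using order.strict_trans[OF _ n] d(2) by auto
    then show "x \<in> (\<Union>n. F n)" by blast
  qed
  obtain n where "emeasure N (G \<inter> (A - F n)) < ennreal e"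
  proof (rule decseq_emeasure_less[of "\<lambda>n. G \<inter> (A - F n)" N "ennreal e"])
    show "range (\<lambda>n. G \<inter> (A - F n)) \<subseteq> sets N"
      using borel G(1) A closed by auto
    show "decseq (\<lambda>n. G \<inter> (A - F n))"
      using \<open>incseq F\<close> by (auto simp: decseq_def incseq_def)
    have Gm: "G \<in> sets N" using borel G(1) by auto
    show "emeasure N (G \<inter> (A - F n)) < \<infinity>" for n
      by (rule le_less_trans[OF emeasure_mono G(2)]) (use Gm in auto)
    have "(\<Inter>n. G \<inter> (A - F n)) = {}" using cover by blast
    then show "emeasure N (\<Inter>n. G \<inter> (A - F n)) < ennreal e" using e by simp
  qed
  with closed sub that show ?thesis by blast
qed

text \<open>The sets that can be squeezed between a closed and an open set form a
  \<open>\<sigma>\<close>-algebra: complements exchange the two sets, and for a countable union the open sets are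
  united with errors from a geometric series, whereas only finitely many of the closed sets are
  united, so that the union stays closed. Finiteness of the measure on \<open>G\<close> makes continuity from above
  available for this truncation.\<close>

lemma Borel_approximable_by_closed_and_open:
  fixes N :: "'a::metric_space measure"
  assumes borel: "sets borel \<subseteq> sets N" and G: "open G" "emeasure N G < \<infinity>"
    and A: "A \<in> sets borel"
  shows "\<forall>e>0. \<exists>F U. closed F \<and> open U \<and> F \<subseteq> A \<and> A \<subseteq> U \<and> emeasure N (G \<inter> (U - F)) < ennreal e"
proof -
  have Gm: "G \<in> sets N" using borel G(1) by auto
  have "A \<in> sigma_sets UNIV {S. open S}"
    using A by (simp add: borel_def)
  then show ?thesis
  proof induction
    case (Basic A)
    then have A: "open A" by simp
    show ?case
    proof (intro allI impI)
      fix e :: real assume "0 < e"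
      from open_approximable_from_inside[OF borel G A this]
      obtain F where "closed F" "F \<subseteq> A" "emeasure N (G \<inter> (A - F)) < ennreal e" .
      then show "\<exists>F U. closed F \<and> open U \<and> F \<subseteq> A \<and> A \<subseteq> U \<and>
          emeasure N (G \<inter> (U - F)) < ennreal e"
        using A by blast
    qed
  next
    case Empty
    show ?case
    proof (intro allI impI)
      fix e :: real assume "0 < e"
      then have "emeasure N (G \<inter> ({} - {})) < ennreal e" by simp
      moreover have "closed ({} :: 'a set)" "open ({} :: 'a set)" by simp_all
      ultimately show "\<exists>F U. closed F \<and> open U \<and> F \<subseteq> {} \<and> {} \<subseteq> U \<and>
          emeasure N (G \<inter> (U - F)) < ennreal e"
        by blast
    qed
  next
    case (Compl A)
    show ?case
    proof (intro allI impI)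
      fix e :: real assume "0 < e"
      from Compl.IH[rule_format, OF this] obtain F U where FU: "closed F" "open U" "F \<subseteq> A"
        "A \<subseteq> U" "emeasure N (G \<inter> (U - F)) < ennreal e" by metis
      show "\<exists>F U. closed F \<and> open U \<and> F \<subseteq> UNIV - A \<and> UNIV - A \<subseteq> U \<and>
          emeasure N (G \<inter> (U - F)) < ennreal e"
      proof (intro exI conjI)
        show "closed (- U)" "open (- F)" "- U \<subseteq> UNIV - A" "UNIV - A \<subseteq> - F"
          using FU by auto
        have "(- F) - (- U) = U - F" by auto
        with FU show "emeasure N (G \<inter> (- F - - U)) < ennreal e" by simp
      qed
    qed
  next
    case (Union A)
    show ?case
    proof (intro allI impI)
      fix e :: real assume e: "0 < e"
      \<comment> \<open>The errors sum up to \<open>e / 2\<close>; the other half is spent on truncating the union of closed sets.\<close>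
      have "\<exists>F U. closed F \<and> open U \<and> F \<subseteq> A i \<and> A i \<subseteq> U \<and>
          emeasure N (G \<inter> (U - F)) < ennreal (e / 2 * (1/2) ^ Suc i)" for i
        by (rule Union.IH[rule_format]) (use e in auto)
      then obtain F U where FU: "\<And>i. closed (F i)" "\<And>i. open (U i)" "\<And>i. F i \<subseteq> A i"
        "\<And>i. A i \<subseteq> U i" "\<And>i. emeasure N (G \<inter> (U i - F i)) < ennreal (e / 2 * (1/2) ^ Suc i)"
        by metis
      have m: "F i \<in> sets N" "U i \<in> sets N" for i
        using FU(1,2) borel by auto
      define B where "B n = G \<inter> ((\<Union>i. U i) - (\<Union>i<n. F i))" for n
      have Bm: "range B \<subseteq> sets N"
        unfolding B_def using m Gm by auto
      have "emeasure N (\<Inter>n. B n) \<le> emeasure N (\<Union>i. G \<inter> (U i - F i))"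
      proof (rule emeasure_mono)
        show "(\<Inter>n. B n) \<subseteq> (\<Union>i. G \<inter> (U i - F i))"
        proof
          fix x assume "x \<in> (\<Inter>n. B n)"
          then have x: "x \<in> B n" for n by blast
          then have "x \<in> G" "x \<in> (\<Union>i. U i)" by (auto simp: B_def)
          then obtain i where "x \<in> U i" by blast
          moreover have "x \<notin> F i" using x[of "Suc i"] by (auto simp: B_def)
          ultimately show "x \<in> (\<Union>i. G \<inter> (U i - F i))" using \<open>x \<in> G\<close> by blast
        qed
      qed (use m Gm in auto)
      also have "\<dots> \<le> (\<Sum>i. emeasure N (G \<inter> (U i - F i)))"
        by (rule emeasure_subadditive_countably) (use m Gm in auto)
      also have "\<dots> \<le> (\<Sum>i. ennreal (e / 2 * (1/2) ^ Suc i))"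
        using FU(5) by (intro suminf_le) (auto intro: less_imp_le)
      also have "\<dots> = ennreal (e / 2)"
        using sums_mult[OF power_half_series, of "e/2"] e
        by (intro suminf_ennreal_eq) auto
      also have "\<dots> < ennreal e" using e by (simp add: ennreal_less_iff)
      finally have less: "emeasure N (\<Inter>n. B n) < ennreal e" .
      obtain n where n: "emeasure N (B n) < ennreal e"
      proof (rule decseq_emeasure_less[OF Bm _ _ less])
        show "decseq B" unfolding B_def decseq_def by auto
        show "emeasure N (B n) < \<infinity>" for n
          by (rule le_less_trans[OF emeasure_mono G(2)]) (use Gm in \<open>auto simp: B_def\<close>)
      qed
      show "\<exists>F U. closed F \<and> open U \<and> F \<subseteq> \<Union> (range A) \<and> \<Union> (range A) \<subseteq> U \<and>
          emeasure N (G \<inter> (U - F)) < ennreal e"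
      proof (intro exI conjI)
        show "closed (\<Union>i<n. F i)" using FU(1) by (intro closed_UN) auto
        show "open (\<Union>i. U i)" using FU(2) by (intro open_UN) auto
        show "(\<Union>i<n. F i) \<subseteq> (\<Union>i. A i)" "(\<Union>i. A i) \<subseteq> (\<Union>i. U i)"
          using FU(3,4) by fast+
        show "emeasure N (G \<inter> ((\<Union>i. U i) - (\<Union>i<n. F i))) < ennreal e"
          using n unfolding B_def .
      qed
    qed
  qed
qed

text \<open>Outer approximation by open sets carries the inequality from open sets to Borel sets inside each
  \<open>G n\<close>; monotone convergence removes the restriction to \<open>G n\<close>.\<close>

lemma emeasure_le_on_Borel_if_le_on_open:
  fixes M N :: "'a::metric_space measure"
  assumes M: "sets borel \<subseteq> sets M" and N: "sets borel \<subseteq> sets N"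
    and le: "\<And>U. open U \<Longrightarrow> emeasure M U \<le> emeasure N U"
    and G: "\<And>n::nat. open (G n)" "\<And>n. emeasure N (G n) < \<infinity>" "incseq G" "(\<Union>n. G n) = UNIV"
    and A: "A \<in> sets borel"
  shows "emeasure M A \<le> emeasure N A"
proof -
  have step: "emeasure M (A \<inter> G n) \<le> emeasure N A" for n
  proof (rule ennreal_le_epsilon)
    fix e :: real assume e: "0 < e"
    obtain F U where FU: "closed F" "open U" "F \<subseteq> A" "A \<subseteq> U"
      "emeasure N (G n \<inter> (U - F)) < ennreal e"
      using Borel_approximable_by_closed_and_open[OF N G(1,2) A, rule_format, OF e] by metis
    have m: "A \<in> sets M" "U \<in> sets M" "G n \<in> sets M"
      "A \<in> sets N" "U \<in> sets N" "F \<in> sets N" "G n \<in> sets N"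
      using M N A FU(1,2) G(1)[of n] by auto
    have "emeasure M (A \<inter> G n) \<le> emeasure M (U \<inter> G n)"
      using FU m by (intro emeasure_mono) auto
    also have "\<dots> \<le> emeasure N (U \<inter> G n)"
      using FU G by (intro le) auto
    also have "\<dots> \<le> emeasure N (A \<union> G n \<inter> (U - F))"
      using FU m by (intro emeasure_mono) auto
    also have "\<dots> \<le> emeasure N A + emeasure N (G n \<inter> (U - F))"
      using m by (intro emeasure_subadditive) auto
    also have "\<dots> \<le> emeasure N A + ennreal e"
      using FU(5) by (intro add_left_mono) auto
    finally show "emeasure M (A \<inter> G n) \<le> emeasure N A + ennreal e" .
  qed
  have "emeasure M A = emeasure M (\<Union>n. A \<inter> G n)"
    using G(4) by (metis Int_UN_distrib Int_UNIV_right)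
  also have "\<dots> = (SUP n. emeasure M (A \<inter> G n))"
    using G(1,3) A M by (intro SUP_emeasure_incseq[symmetric]) (auto simp: incseq_def)
  also have "\<dots> \<le> emeasure N A"
    by (rule SUP_least) (rule step)
  finally show ?thesis .
qed

section \<open>Ahlfors regular spaces\<close>

lemma dist_le_ediam:
  fixes x y :: "'a::metric_space"
  shows "ennreal (dist x y) \<le> ediam (UNIV :: 'a set)"
proof -
  have "ennreal (dist x y) \<le> (SUP y. ennreal (dist x y))"
    by (rule SUP_upper) simp
  also have "\<dots> \<le> (SUP x::'a. SUP y. ennreal (dist x y))"
    using SUP_upper[of x UNIV "\<lambda>x. SUP y. ennreal (dist x y)"] by simp
  finally show ?thesis by (simp add: ediam_def)
qed

lemma dist_le_if_ediam_eq:
  fixes x y :: "'a::metric_space"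
  assumes "ediam (UNIV :: 'a set) = ennreal D" "0 \<le> D"
  shows "dist x y \<le> D"
  using dist_le_ediam[of x y] assms by (metis ennreal_le_iff)

text \<open>This puts every distance that occurs in the space in the range of radii for which Ahlfors
  regularity gives bounds.\<close>

lemma dist_less_two_ediam:
  fixes x y :: "'a::metric_space"
  assumes "\<exists>a b :: 'a. a \<noteq> b"
  shows "ennreal (dist x y) < 2 * ediam (UNIV :: 'a set)"
proof (cases "ediam (UNIV :: 'a set)" rule: ennreal_cases)
  case (real D)
  obtain a b :: 'a where "a \<noteq> b" using assms by blast
  then have "0 < dist a b" by simp
  also have "dist a b \<le> D"
    using dist_le_if_ediam_eq real by blast
  finally have "0 < D" .
  moreover have "dist x y \<le> D"
    using dist_le_if_ediam_eq real by blast
  ultimately have "dist x y < 2 * D" by simp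
  then have "ennreal (dist x y) < ennreal (2 * D)"
    by (simp add: ennreal_less_iff)
  then show ?thesis using real by (simp add: ennreal_mult)
next
  case top
  then show ?thesis by (simp add: ennreal_mult_top less_top[symmetric])
qed

text \<open>Ahlfors regularity with a fixed constant. The upper bound is required for all radii, which spares
  the case distinction at twice the diameter in covering arguments; the lower bound could not hold
  for large radii in a bounded space.\<close>

locale ahlfors_space =
  fixes M :: "'a::metric_space measure" and Q C :: real
  assumes space_M [simp]: "space M = UNIV"
    and borel_M: "sets borel \<subseteq> sets M"
    and Q_pos: "0 < Q" and C_ge_1: "1 \<le> C"
    and two_points: "\<exists>x y :: 'a. x \<noteq> y"
    and ball_lower: "\<And>z \<rho>. 0 < \<rho> \<Longrightarrow> ennreal \<rho> < 2 * ediam (UNIV :: 'a set) \<Longrightarrow>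
      ennreal (inverse C * \<rho> powr Q) \<le> emeasure M (ball z \<rho>)"
    and ball_upper: "\<And>z \<rho>. 0 < \<rho> \<Longrightarrow> emeasure M (ball z \<rho>) \<le> ennreal (C * \<rho> powr Q)"

text \<open>If the radius is at least twice the diameter \<open>D\<close>, the ball is the whole space, which is also the
  ball of radius \<open>3 / 2 * D\<close>, and the bound for that smaller radius is better than the one claimed.\<close>

lemma ahlfors_regular_imp_ahlfors_space:
  fixes M :: "'a::metric_space measure"
  assumes M: "borel_regular M" "ahlfors_regular M Q" and "0 < Q" and two: "\<exists>x y :: 'a. x \<noteq> y"
  obtains C where "ahlfors_space M Q C"
proof -
  from M(2) obtain C where C: "1 \<le> C" and
    lower: "\<And>z \<rho>. 0 < \<rho> \<Longrightarrow> ennreal \<rho> < 2 * ediam (UNIV :: 'a set) \<Longrightarrow>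
      ennreal (inverse C * \<rho> powr Q) \<le> emeasure M (ball z \<rho>)" and
    upper: "\<And>z \<rho>. 0 < \<rho> \<Longrightarrow> ennreal \<rho> < 2 * ediam (UNIV :: 'a set) \<Longrightarrow>
      emeasure M (ball z \<rho>) \<le> ennreal (C * \<rho> powr Q)"
    unfolding ahlfors_regular_def by blast
  have upper': "emeasure M (ball z \<rho>) \<le> ennreal (C * \<rho> powr Q)" if \<rho>: "0 < \<rho>" for z \<rho>
  proof (cases "ennreal \<rho> < 2 * ediam (UNIV :: 'a set)")
    case True
    with \<rho> show ?thesis by (rule upper)
  next
    case False
    then obtain D where D: "0 \<le> D" "ediam (UNIV :: 'a set) = ennreal D"
      by (cases "ediam (UNIV :: 'a set)" rule: ennreal_cases) (auto simp: ennreal_mult_top)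
    from two obtain a b :: 'a where "a \<noteq> b" by blast
    then have "0 < dist a b" by simp
    then have "0 < D" using dist_le_if_ediam_eq[OF D(2,1), of a b] by linarith
    have two_D: "2 * ediam (UNIV :: 'a set) = ennreal (2 * D)"
      using D by (simp add: ennreal_mult)
    with False have "2 * D \<le> \<rho>" using \<open>0 < D\<close> \<rho> by (simp add: ennreal_less_iff)
    have "ball z (3 / 2 * D) = UNIV"
    proof -
      have "dist z y < 3 / 2 * D" for y
        using dist_le_if_ediam_eq[OF D(2,1), of z y] \<open>0 < D\<close> by simp
      then show ?thesis by auto
    qed
    then have "emeasure M (ball z \<rho>) \<le> emeasure M (ball z (3 / 2 * D))"
      using M(1) by (intro emeasure_mono) (auto simp: borel_regular_def)
    also have "\<dots> \<le> ennreal (C * (3 / 2 * D) powr Q)"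
      using \<open>0 < D\<close> by (intro upper) (auto simp: two_D ennreal_less_iff)
    also have "\<dots> \<le> ennreal (C * \<rho> powr Q)"
      using \<open>0 < D\<close> \<open>2 * D \<le> \<rho>\<close> \<open>0 < Q\<close> C
      by (intro ennreal_leI mult_left_mono powr_mono2) auto
    finally show ?thesis .
  qed
  have "ahlfors_space M Q C"
    using M(1) C lower upper' two \<open>0 < Q\<close>
    by unfold_locales (auto simp: borel_regular_def)
  then show thesis by (rule that)
qed

context ahlfors_space
begin

lemma C_pos: "0 < C" using C_ge_1 by simp

lemma open_in_sets: "open U \<Longrightarrow> U \<in> sets M"
  using borel_M by auto

lemma ball_in_sets: "ball z \<rho> \<in> sets M"
  by (simp add: open_in_sets)

lemma ident_measurable: "(\<lambda>x. x) \<in> measurable M borel"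
  using borel_M by (auto simp: measurable_def)

lemma ball_finite: "emeasure M (ball z \<rho>) < \<infinity>"
proof (cases "0 < \<rho>")
  case True
  then show ?thesis by (auto intro: le_less_trans[OF ball_upper])
next
  case False
  then have "ball z \<rho> = {}" by simp
  then show ?thesis by (metis emeasure_empty ennreal_zero_less_top infinity_ennreal_def)
qed

lemma small_radii:
  obtains \<delta> where "0 < \<delta>" "\<And>\<rho>. \<rho> \<le> \<delta> \<Longrightarrow> ennreal \<rho> < 2 * ediam (UNIV :: 'a set)"
proof -
  obtain x y :: 'a where "x \<noteq> y" using two_points by blast
  then show thesis
    using that[of "dist x y"] dist_less_two_ediam[OF two_points, of x y]
    by (meson ennreal_leI le_less_trans zero_less_dist_iff)
qed

text \<open>Balls of radius \<open>\<rho>\<close> around points of mutual distance at least \<open>2 * \<rho>\<close> are disjoint and each has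
  measure at least a fixed positive number. Hence a separated set has a bounded number of points, a
  separated set of largest cardinality exists, and by maximality it is a net. The bound on its
  cardinality is what replaces the Vitali covering theorem below.\<close>

lemma finite_net:
  assumes G: "G \<in> sets M" "emeasure M G < \<infinity>"
    and \<rho>: "0 < \<rho>" "ennreal \<rho> < 2 * ediam (UNIV :: 'a set)"
    and S: "\<And>x. x \<in> S \<Longrightarrow> ball x \<rho> \<subseteq> G"
  obtains N where "finite N" "N \<subseteq> S" "S \<subseteq> (\<Union>x\<in>N. ball x (2 * \<rho>))"
    "ennreal (real (card N) * (inverse C * \<rho> powr Q)) \<le> emeasure M G"
proof -
  define sep where
    "sep T \<longleftrightarrow> finite T \<and> T \<subseteq> S \<and> (\<forall>x\<in>T. \<forall>y\<in>T. x \<noteq> y \<longrightarrow> 2 * \<rho> \<le> dist x y)" for T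
  define c where "c = inverse C * \<rho> powr Q"
  have c: "0 < c" using C_pos \<rho> by (simp add: c_def)
  have bound: "ennreal (real (card T) * c) \<le> emeasure M G" if T: "sep T" for T
  proof -
    have fin: "finite T" and sub: "T \<subseteq> S" using T by (auto simp: sep_def)
    have "disjoint_family_on (\<lambda>x. ball x \<rho>) T"
      unfolding disjoint_family_on_def
    proof (intro ballI impI)
      fix x y assume "x \<in> T" "y \<in> T" "x \<noteq> y"
      then have "2 * \<rho> \<le> dist x y" using T by (simp add: sep_def)
      then show "ball x \<rho> \<inter> ball y \<rho> = {}"
        by (intro disjoint_ballI) simp
    qed
    then have "(\<Sum>x\<in>T. emeasure M (ball x \<rho>)) = emeasure M (\<Union>x\<in>T. ball x \<rho>)"
      using fin ball_in_sets by (intro sum_emeasure) auto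
    also have "\<dots> \<le> emeasure M G"
      using sub S by (intro emeasure_mono G(1)) auto
    finally have le: "(\<Sum>x\<in>T. emeasure M (ball x \<rho>)) \<le> emeasure M G" .
    have "ennreal (real (card T) * c) = (\<Sum>x\<in>T. ennreal c)"
      using c by (simp add: ennreal_mult ennreal_of_nat_eq_real_of_nat)
    also have "\<dots> \<le> (\<Sum>x\<in>T. emeasure M (ball x \<rho>))"
      unfolding c_def using ball_lower[OF \<rho>] by (intro sum_mono) auto
    finally show ?thesis using le by simp
  qed
  obtain m where m: "0 \<le> m" "emeasure M G = ennreal m"
    using G(2) by (cases "emeasure M G" rule: ennreal_cases) auto
  have card_bound: "card T \<le> nat \<lfloor>m / c\<rfloor>" if "sep T" for T
  proof -
    have "real (card T) * c \<le> m"
      using bound[OF that] m by simp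
    then have "real (card T) \<le> m / c" using c by (simp add: pos_le_divide_eq)
    then show ?thesis by (simp add: le_nat_floor)
  qed
  have "sep {}" by (simp add: sep_def)
  then obtain N where N: "sep N" "\<And>T. sep T \<Longrightarrow> card T \<le> card N"
    using ex_has_greatest_nat[of sep "{}" card "Suc (nat \<lfloor>m / c\<rfloor>)"] card_bound
    by (metis le_imp_less_Suc)
  have "S \<subseteq> (\<Union>x\<in>N. ball x (2 * \<rho>))"
  proof (rule ccontr)
    assume "\<not> ?thesis"
    then obtain y where "y \<in> S" "y \<notin> (\<Union>x\<in>N. ball x (2 * \<rho>))" by blast
    then have y: "y \<in> S" "\<And>x. x \<in> N \<Longrightarrow> 2 * \<rho> \<le> dist x y"
      by (auto simp: not_less)
    then have "y \<notin> N" using \<rho>(1) by force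
    have "sep (insert y N)"
      using N(1) y by (auto simp: sep_def dist_commute)
    from N(2)[OF this] show False
      using \<open>y \<notin> N\<close> N(1) by (simp add: sep_def)
  qed
  then show thesis
    using that[of N] N(1) bound[OF N(1)] by (auto simp: sep_def c_def)
qed

text \<open>Finite nets of ever smaller scale in ever larger balls.\<close>

lemma countable_dense:
  obtains D :: "'a set" where "countable D" "\<And>x e. 0 < e \<Longrightarrow> \<exists>d\<in>D. dist x d < e"
proof -
  obtain \<delta> where \<delta>: "0 < \<delta>" "\<And>\<rho>. \<rho> \<le> \<delta> \<Longrightarrow> ennreal \<rho> < 2 * ediam (UNIV :: 'a set)"
    using small_radii by metis
  obtain a :: 'a where True by blast
  define \<rho> where "\<rho> k = min \<delta> 1 / real (Suc k)" for k
  have \<rho>: "0 < \<rho> k" "\<rho> k \<le> \<delta>" "\<rho> k \<le> 1" for k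
  proof -
    show "0 < \<rho> k" using \<delta>(1) by (simp add: \<rho>_def)
    have "\<rho> k \<le> min \<delta> 1 / 1"
      unfolding \<rho>_def using \<delta>(1) by (intro divide_left_mono) auto
    then show "\<rho> k \<le> \<delta>" "\<rho> k \<le> 1" by auto
  qed
  have "\<exists>N. finite N \<and> ball a (real n) \<subseteq> (\<Union>x\<in>N. ball x (2 * \<rho> k))" for n k
  proof -
    have "ball x (\<rho> k) \<subseteq> ball a (real n + 1)" if "x \<in> ball a (real n)" for x
    proof
      fix y assume "y \<in> ball x (\<rho> k)"
      then show "y \<in> ball a (real n + 1)"
        using that \<rho>(3)[of k] dist_triangle[of a y x] by simp
    qed
    from finite_net[OF ball_in_sets ball_finite \<rho>(1)[of k] \<delta>(2)[OF \<rho>(2)[of k]] this]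
    show ?thesis by metis
  qed
  then obtain N where N: "\<And>n k. finite (N n k)"
    "\<And>n k. ball a (real n) \<subseteq> (\<Union>x\<in>N n k. ball x (2 * \<rho> k))" by metis
  show thesis
  proof (rule that[of "\<Union>n. \<Union>k. N n k"])
    show "countable (\<Union>n. \<Union>k. N n k)"
      by (intro countable_UN countable_finite[OF N(1)]) auto
    fix x :: 'a and e :: real assume e: "0 < e"
    obtain n where n: "dist a x < real n" using reals_Archimedean2 by blast
    obtain k where k: "inverse (real (Suc k)) < e / 2"
      using reals_Archimedean[of "e / 2"] e by auto
    have "\<rho> k \<le> 1 / real (Suc k)"
      unfolding \<rho>_def by (intro divide_right_mono) auto
    with k have "2 * \<rho> k < e" by (simp add: inverse_eq_divide)
    from n N(2)[of n k] obtain d where "d \<in> N n k" "dist d x < 2 * \<rho> k"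
      by auto
    with \<open>2 * \<rho> k < e\<close> show "\<exists>d\<in>\<Union>n. \<Union>k. N n k. dist x d < e"
      by (intro bexI[of _ d] UN_I) (auto simp: dist_commute)
  qed
qed

text \<open>The distance is continuous, but a priori the product of the Borel \<open>\<sigma>\<close>-algebras may be smaller
  than the Borel \<open>\<sigma>\<close>-algebra of the product. Separability helps: \<open>dist x y\<close> is the infimum of
  \<open>dist x d + dist y d\<close> over a countable dense set of points \<open>d\<close>.\<close>

lemma dist_measurable:
  "(\<lambda>p. dist (fst p) (snd p)) \<in> borel_measurable (M \<Otimes>\<^sub>M M)"
proof (rule borel_measurable_iff_less[THEN iffD2], rule allI)
  fix t :: real
  obtain D :: "'a set" where D: "countable D" "\<And>x e. 0 < e \<Longrightarrow> \<exists>d\<in>D. dist x d < e"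
    using countable_dense by metis
  have "(\<lambda>x. dist x d) \<in> borel_measurable M" for d
    using ident_measurable by (rule borel_measurable_continuous_on[rotated]) (intro continuous_intros)
  then have [measurable]: "(\<lambda>x. dist x d) \<in> borel_measurable M" for d .
  have "{p \<in> space (M \<Otimes>\<^sub>M M). dist (fst p) (snd p) < t} =
      (\<Union>d\<in>D. {p \<in> space (M \<Otimes>\<^sub>M M). dist (fst p) d + dist (snd p) d < t})"
  proof (intro equalityI subsetI)
    fix p assume p: "p \<in> {p \<in> space (M \<Otimes>\<^sub>M M). dist (fst p) (snd p) < t}"
    then obtain d where d: "d \<in> D" "dist (fst p) d < (t - dist (fst p) (snd p)) / 2"
      using D(2)[of "(t - dist (fst p) (snd p)) / 2" "fst p"] by auto
    have "dist (snd p) d \<le> dist (fst p) (snd p) + dist (fst p) d"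
      using dist_triangle[of "snd p" d "fst p"] by (simp add: dist_commute)
    moreover have "2 * dist (fst p) d < t - dist (fst p) (snd p)"
      using d(2) by simp
    ultimately have "dist (fst p) d + dist (snd p) d < t" by linarith
    with p d(1) show "p \<in> (\<Union>d\<in>D. {p \<in> space (M \<Otimes>\<^sub>M M). dist (fst p) d + dist (snd p) d < t})"
      by auto
  next
    fix p assume "p \<in> (\<Union>d\<in>D. {p \<in> space (M \<Otimes>\<^sub>M M). dist (fst p) d + dist (snd p) d < t})"
    then show "p \<in> {p \<in> space (M \<Otimes>\<^sub>M M). dist (fst p) (snd p) < t}"
      using dist_triangle2[of "fst p" "snd p"] by (auto intro: le_less_trans)
  qed
  also have "\<dots> \<in> sets (M \<Otimes>\<^sub>M M)"
    using D(1) by (intro sets.countable_UN'') measurable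
  finally show "{p \<in> space (M \<Otimes>\<^sub>M M). dist (fst p) (snd p) < t} \<in> sets (M \<Otimes>\<^sub>M M)" .
qed

lemma sigma_finite: "sigma_finite_measure M"
proof
  obtain a :: 'a where True by blast
  show "\<exists>A. countable A \<and> A \<subseteq> sets M \<and> \<Union> A = space M \<and> (\<forall>a\<in>A. emeasure M a \<noteq> \<infinity>)"
  proof (intro exI conjI)
    show "\<Union> (range (\<lambda>n. ball a (real n))) = space M"
      using reals_Archimedean2 by auto
    show "\<forall>A\<in>range (\<lambda>n. ball a (real n)). emeasure M A \<noteq> \<infinity>"
      using ball_finite less_top by auto
  qed (auto simp: open_in_sets)
qed

text \<open>The dyadic annulus of inner radius \<open>2 ^ j * r\<close> contributes at most a constant times
  \<open>(2 ^ j * r) powr - (a + Q) * (2 ^ j * r) powr Q\<close>, and these numbers form a geometric series of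
  ratio \<open>2 powr - a\<close>.\<close>

lemma tail_bound:
  assumes "0 < a" "0 < r"
  obtains T where "0 \<le> T"
    "\<And>y. (\<integral>\<^sup>+x. ennreal (indicator {r..} (dist x y) * dist x y powr - (a + Q)) \<partial>M) \<le> ennreal T"
proof -
  define q where "q = 2 powr - a"
  have q: "0 < q" "q < 1" using assms by (auto simp: q_def powr_less_one)
  define K where "K = C * 2 powr Q * r powr - a"
  have K: "0 \<le> K" using C_pos by (simp add: K_def)
  define c where "c j = (2 ^ j * r) powr - (a + Q)" for j :: nat
  have term_le: "g j \<le> suminf g" for g :: "nat \<Rightarrow> ennreal" and j
    using sum_le_suminf[of g "{j}"] by simp
  have pointwise: "ennreal (indicator {r..} (dist x y) * dist x y powr - (a + Q))
      \<le> (\<Sum>j. ennreal (c j) * indicator (ball y (2 ^ Suc j * r)) x)" for x y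
  proof (cases "r \<le> dist x y")
    case False
    then show ?thesis by simp
  next
    case True
    let ?t = "dist x y / r"
    have t: "1 \<le> ?t" using True assms by simp
    define j where "j = nat \<lfloor>log 2 ?t\<rfloor>"
    have "0 \<le> log 2 ?t" using t by (subst zero_le_log_cancel_iff) auto
    then have "real j \<le> log 2 ?t" "log 2 ?t < real (Suc j)"
      unfolding j_def by linarith+
    then have "2 powr real j \<le> ?t" "?t < 2 powr real (Suc j)"
      using t by (simp_all add: le_log_iff log_less_iff)
    then have j: "2 ^ j * r \<le> dist x y" "dist x y < 2 ^ Suc j * r"
      using assms by (simp_all add: powr_realpow pos_le_divide_eq pos_divide_less_eq del: power_Suc of_nat_Suc)
    have "dist x y powr - (a + Q) \<le> c j"
      unfolding c_def using j assms Q_pos by (intro powr_mono2') auto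
    then have "ennreal (indicator {r..} (dist x y) * dist x y powr - (a + Q))
      \<le> ennreal (c j) * indicator (ball y (2 ^ Suc j * r)) x"
      using True j(2) by (simp add: dist_commute ennreal_leI)
    also have "\<dots> \<le> (\<Sum>j. ennreal (c j) * indicator (ball y (2 ^ Suc j * r)) x)"
      by (rule term_le)
    finally show ?thesis .
  qed
  have term_bound: "ennreal (c j) * emeasure M (ball y (2 ^ Suc j * r)) \<le> ennreal (K * q ^ j)" for j y
  proof -
    have pow: "(2 ^ j) powr - a = q ^ j"
      unfolding q_def by (simp add: powr_realpow[symmetric] powr_powr mult.commute)
    have "(2 ^ Suc j * r) powr Q = 2 powr Q * (2 ^ j * r) powr Q"
      using assms by (simp add: powr_mult)
    then have "c j * (C * (2 ^ Suc j * r) powr Q) = C * 2 powr Q * (2 ^ j * r) powr - a"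
      unfolding c_def using assms by (simp add: powr_add[symmetric] minus_add_distrib)
    also have "\<dots> = K * q ^ j"
      unfolding K_def pow[symmetric] using assms by (simp add: powr_mult)
    finally have eq: "c j * (C * (2 ^ Suc j * r) powr Q) = K * q ^ j" .
    have "ennreal (c j) * emeasure M (ball y (2 ^ Suc j * r))
        \<le> ennreal (c j) * ennreal (C * (2 ^ Suc j * r) powr Q)"
      using assms by (intro mult_left_mono ball_upper) auto
    also have "\<dots> = ennreal (K * q ^ j)"
      unfolding eq[symmetric] using C_pos by (intro ennreal_mult[symmetric]) (auto simp: c_def)
    finally show ?thesis .
  qed
  show thesis
  proof (rule that[of "K / (1 - q)"])
    show "0 \<le> K / (1 - q)" using K q by simp
    fix y
    have "(\<integral>\<^sup>+x. ennreal (indicator {r..} (dist x y) * dist x y powr - (a + Q)) \<partial>M)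
        \<le> (\<integral>\<^sup>+x. (\<Sum>j. ennreal (c j) * indicator (ball y (2 ^ Suc j * r)) x) \<partial>M)"
      by (intro nn_integral_mono pointwise)
    also have "\<dots> = (\<Sum>j. \<integral>\<^sup>+x. ennreal (c j) * indicator (ball y (2 ^ Suc j * r)) x \<partial>M)"
      using ball_in_sets by (intro nn_integral_suminf) auto
    also have "\<dots> = (\<Sum>j. ennreal (c j) * emeasure M (ball y (2 ^ Suc j * r)))"
      using ball_in_sets by (simp add: nn_integral_cmult_indicator)
    also have "\<dots> \<le> (\<Sum>j. ennreal (K * q ^ j))"
      using term_bound by (intro suminf_le) auto
    also have "\<dots> = ennreal (K / (1 - q))"
      using sums_mult[OF geometric_sums[of q], of K] q K
      by (intro suminf_ennreal_eq) auto
    finally show "(\<integral>\<^sup>+x. ennreal (indicator {r..} (dist x y) * dist x y powr - (a + Q)) \<partial>M)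
        \<le> ennreal (K / (1 - q))" .
  qed
qed

end

section \<open>Comparison of the measures under the homeomorphism\<close>

text \<open>For a finite net \<open>N\<close> of scale \<open>\<rho>\<close>, the preimages of the balls of radius \<open>2 * \<rho>\<close> lie in balls of
  radius comparable to \<open>\<rho> powr (1 / \<theta>)\<close>, of measure at most a constant times
  \<open>\<rho> powr (QZ / \<theta>) \<le> \<rho> powr QW\<close>; so the preimage has measure at most a constant times
  \<open>card N * \<rho> powr QW\<close>, which is at most a constant times the measure of \<open>U\<close>.

  The lower Hoelder bound only speaks of points of distance less than \<open>r\<close>, and \<open>f\<close> may bring
  distant points arbitrarily close together. Therefore \<open>U\<close> is exhausted by sets \<open>V n\<close> of points
  \<open>w\<close> whose balls of radius \<open>1 / (n + 1)\<close> stay in \<open>U\<close> and have preimages within distance \<open>r / 2\<close>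
  of \<open>g w\<close>.
  Continuity of \<open>g\<close> makes every point of \<open>U\<close> belong to some \<open>V n\<close>, and the constant does not depend
  on \<open>n\<close>.\<close>

lemma open_preimage_measure_bound:
  fixes f :: "'z::metric_space \<Rightarrow> 'w::metric_space"
  assumes Z: "ahlfors_space \<nu>Z QZ CZ" and W: "ahlfors_space \<nu>W QW CW"
    and hom: "homeomorphism UNIV UNIV f g"
    and \<theta>: "0 < \<theta>" "\<theta> * QW \<le> QZ" and r: "0 < r" and L: "1 \<le> L"
    and lower: "\<And>x y. dist x y < r \<Longrightarrow> inverse L * dist x y powr \<theta> \<le> dist (f x) (f y)"
  obtains K where "0 < K" "\<And>U. open U \<Longrightarrow> emeasure \<nu>Z (f -` U) \<le> ennreal K * emeasure \<nu>W U"
proof -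
  interpret Z: ahlfors_space \<nu>Z QZ CZ by fact
  interpret W: ahlfors_space \<nu>W QW CW by fact
  have f: "continuous_on UNIV f" and g: "continuous_on UNIV g"
    and gf [simp]: "\<And>x. g (f x) = x" and fg [simp]: "\<And>y. f (g y) = y"
    using hom by (auto simp: homeomorphism_def)
  have preimage_sets: "f -` A \<in> sets \<nu>Z" if "open A \<or> closed A" for A
  proof -
    from that have "open (f -` A) \<or> closed (f -` A)"
      using open_vimage[OF _ f] closed_vimage[OF _ f] by auto
    then show ?thesis using Z.borel_M by auto
  qed
  obtain \<delta> where \<delta>: "0 < \<delta>" "\<And>\<rho>. \<rho> \<le> \<delta> \<Longrightarrow> ennreal \<rho> < 2 * ediam (UNIV :: 'w set)"
    using W.small_radii by metis
  define B where "B = (2 * L) powr (QZ / \<theta>)"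
  define K where "K = CZ * B * CW"
  have B: "0 < B" using L by (simp add: B_def)
  have K: "0 < K" using Z.C_pos W.C_pos B by (simp add: K_def)
  have "emeasure \<nu>Z (f -` U) \<le> ennreal K * emeasure \<nu>W U" if U: "open U" for U
  proof (cases "emeasure \<nu>W U = \<infinity>")
    case True
    then show ?thesis using K by (simp add: ennreal_mult_top)
  next
    case False
    then have fin: "emeasure \<nu>W U < \<infinity>" by (simp add: less_top)
    define e where "e n = inverse (real (Suc n))" for n
    have e: "0 < e n" "e n \<le> 1" for n
      by (simp_all add: e_def field_simps)
    \<comment> \<open>Written as the complement of a union of open sets to make its closedness visible.\<close>
    define V where
      "V n = - (\<Union>v. ball v (e n) \<inter> {w. v \<notin> U \<or> r / 2 < dist (g w) (g v)})" for n
    have V_iff: "w \<in> V n \<longleftrightarrow> (\<forall>v. dist w v < e n \<longrightarrow> v \<in> U \<and> dist (g w) (g v) \<le> r / 2)" for w n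
      by (auto simp: V_def dist_commute not_less) (meson leD)+
    have V_closed: "closed (V n)" for n
      unfolding V_def
      by (intro closed_Compl open_UN ballI open_Int open_ball open_Collect_disj open_Collect_const
          open_Collect_less continuous_intros g)
    have "V m \<subseteq> V n" if "m \<le> n" for m n
    proof -
      have "e n \<le> e m"
        unfolding e_def using that by (intro le_imp_inverse_le) auto
      then show ?thesis by (auto simp: V_iff)
    qed
    then have "incseq V" by (simp add: incseq_def)
    have V_Union: "(\<Union>n. V n) = U"
    proof (intro equalityI subsetI)
      fix w assume "w \<in> (\<Union>n. V n)"
      then obtain n where "w \<in> V n" by blast
      then show "w \<in> U" using e(1)[of n] by (auto simp: V_iff)
    next
      fix w assume "w \<in> U"
      then obtain d1 where d1: "0 < d1" "\<And>v. dist v w < d1 \<Longrightarrow> v \<in> U"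
        using U by (auto simp: open_dist)
      obtain d2 where d2: "0 < d2" "\<And>v. dist v w < d2 \<Longrightarrow> dist (g v) (g w) < r / 2"
        using g r unfolding continuous_on_iff by (metis UNIV_I half_gt_zero)
      obtain n where n: "e n < min d1 d2"
        using reals_Archimedean[of "min d1 d2"] d1(1) d2(1) unfolding e_def by auto
      have "w \<in> V n"
        unfolding V_iff
      proof (intro allI impI)
        fix v assume "dist w v < e n"
        then have "dist v w < d1" "dist v w < d2" using n by (auto simp: dist_commute)
        then show "v \<in> U \<and> dist (g w) (g v) \<le> r / 2"
          using d1(2) d2(2)[of v] by (simp add: dist_commute)
      qed
      then show "w \<in> (\<Union>n. V n)" by blast
    qed
    have step: "emeasure \<nu>Z (f -` V n) \<le> ennreal K * emeasure \<nu>W U" for n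
    proof -
      \<comment> \<open>The factor 1/2 makes balls of radius \<open>2 * \<rho>\<close> fit into the scale \<open>e n\<close>.\<close>
      define \<rho> where "\<rho> = min \<delta> (e n) / 2"
      have \<rho>: "0 < \<rho>" "\<rho> \<le> \<delta>" "2 * \<rho> \<le> e n" "\<rho> \<le> 1"
        using \<delta>(1) e[of n] by (auto simp: \<rho>_def)
      have "ball w \<rho> \<subseteq> U" if "w \<in> V n" for w
        using that \<rho> by (auto simp: V_iff)
      from W.finite_net[OF W.open_in_sets[OF U] fin \<rho>(1) \<delta>(2)[OF \<rho>(2)] this]
      obtain N where N: "finite N" "N \<subseteq> V n" "V n \<subseteq> (\<Union>w\<in>N. ball w (2 * \<rho>))"
        "ennreal (real (card N) * (inverse CW * \<rho> powr QW)) \<le> emeasure \<nu>W U"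
        by metis
      define R where "R = (2 * L * \<rho>) powr (1 / \<theta>)"
      have R: "0 < R" using L \<rho> by (simp add: R_def)
      have "f -` ball w (2 * \<rho>) \<subseteq> ball (g w) R" if "w \<in> N" for w
      proof
        fix x assume "x \<in> f -` ball w (2 * \<rho>)"
        then have x: "dist w (f x) < 2 * \<rho>" by simp
        then have "dist (g w) (g (f x)) \<le> r / 2"
          using N(2) that \<rho>(3) V_iff[of w n] by (meson less_le_trans subsetD)
        then have "dist (g w) x < r" using r by simp
        from lower[OF this] have "inverse L * dist (g w) x powr \<theta> < 2 * \<rho>" using x by simp
        then have "dist (g w) x powr \<theta> < 2 * L * \<rho>" using L by (simp add: field_simps)
        then have "(dist (g w) x powr \<theta>) powr (1 / \<theta>) < R"
          unfolding R_def using \<theta>(1) by (intro powr_less_mono2) auto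
        then show "x \<in> ball (g w) R" using \<theta>(1) by (simp add: powr_powr)
      qed
      then have sub: "f -` V n \<subseteq> (\<Union>w\<in>N. ball (g w) R)" using N(3) by fastforce
      have "R powr QZ = B * \<rho> powr (QZ / \<theta>)"
        using L \<rho> by (simp add: R_def B_def powr_powr powr_mult)
      also have "\<dots> \<le> B * \<rho> powr QW"
        using \<rho> \<theta> B by (intro mult_left_mono powr_mono') (auto simp: field_simps)
      finally have R_QZ: "R powr QZ \<le> B * \<rho> powr QW" .
      have "emeasure \<nu>Z (f -` V n) \<le> emeasure \<nu>Z (\<Union>w\<in>N. ball (g w) R)"
        using sub N(1) Z.ball_in_sets by (intro emeasure_mono) auto
      also have "\<dots> \<le> (\<Sum>w\<in>N. emeasure \<nu>Z (ball (g w) R))"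
        using N(1) Z.ball_in_sets by (intro emeasure_subadditive_finite) auto
      also have "\<dots> \<le> (\<Sum>w\<in>N. ennreal (CZ * (B * \<rho> powr QW)))"
        using R R_QZ Z.C_pos
        by (intro sum_mono order_trans[OF Z.ball_upper[OF R]] ennreal_leI mult_left_mono) auto
      also have "\<dots> = ennreal (real (card N) * (CZ * (B * \<rho> powr QW)))"
        using Z.C_pos B by (simp add: ennreal_mult ennreal_of_nat_eq_real_of_nat)
      also have "real (card N) * (CZ * (B * \<rho> powr QW)) =
          K * (real (card N) * (inverse CW * \<rho> powr QW))"
        using W.C_pos by (simp add: K_def)
      also have "ennreal \<dots> = ennreal K * ennreal (real (card N) * (inverse CW * \<rho> powr QW))"
        using K W.C_pos by (intro ennreal_mult) auto
      also have "\<dots> \<le> ennreal K * emeasure \<nu>W U"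
        using N(4) by (intro mult_left_mono) auto
      finally show ?thesis .
    qed
    have "emeasure \<nu>Z (f -` U) = emeasure \<nu>Z (\<Union>n. f -` V n)"
      by (simp flip: V_Union add: vimage_UN)
    also have "\<dots> = (SUP n. emeasure \<nu>Z (f -` V n))"
      using \<open>incseq V\<close> preimage_sets V_closed
      by (intro SUP_emeasure_incseq[symmetric]) (auto simp: incseq_def)
    also have "\<dots> \<le> ennreal K * emeasure \<nu>W U"
      by (rule SUP_least) (rule step)
    finally show ?thesis .
  qed
  with K that show thesis by metis
qed

lemma Borel_preimage_measure_bound:
  fixes f :: "'z::metric_space \<Rightarrow> 'w::metric_space"
  assumes Z: "ahlfors_space \<nu>Z QZ CZ" and W: "ahlfors_space \<nu>W QW CW"
    and f: "continuous_on UNIV f"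
    and le: "\<And>U. open U \<Longrightarrow> emeasure \<nu>Z (f -` U) \<le> ennreal K * emeasure \<nu>W U"
    and A: "A \<in> sets borel"
  shows "emeasure \<nu>Z (f -` A) \<le> ennreal K * emeasure \<nu>W A"
proof -
  interpret Z: ahlfors_space \<nu>Z QZ CZ by fact
  interpret W: ahlfors_space \<nu>W QW CW by fact
  have meas: "f \<in> measurable \<nu>Z borel"
    using borel_measurable_continuous_on[OF f Z.ident_measurable] .
  have distr: "emeasure (distr \<nu>Z borel f) A = emeasure \<nu>Z (f -` A)" if "A \<in> sets borel" for A
    using meas that by (simp add: emeasure_distr)
  obtain a :: 'w where True by blast
  have "emeasure (distr \<nu>Z borel f) A \<le> emeasure (scale_measure (ennreal K) \<nu>W) A"
  proof (rule emeasure_le_on_Borel_if_le_on_open[where G = "\<lambda>n. ball a (real n)"])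
    show "emeasure (distr \<nu>Z borel f) U \<le> emeasure (scale_measure (ennreal K) \<nu>W) U"
      if "open U" for U
      using le[OF that] that by (simp add: distr)
    show "emeasure (scale_measure (ennreal K) \<nu>W) (ball a (real n)) < \<infinity>" for n
      using W.ball_finite[of a "real n"] by (simp add: ennreal_mult_less_top)
    show "incseq (\<lambda>n. ball a (real n))"
      by (auto simp: incseq_def)
    show "(\<Union>n. ball a (real n)) = UNIV"
      using reals_Archimedean2 by auto
  qed (use A W.borel_M in auto)
  then show ?thesis using A by (simp add: distr)
qed

text \<open>Borel hulls in \<open>\<nu>W\<close> and completeness of \<open>\<nu>Z\<close> carry both measurability and the bound from Borel
  sets to all measurable sets: the preimage of a null set is contained in a null set.\<close>

lemma preimage_measure_bound:
  fixes f :: "'z::metric_space \<Rightarrow> 'w::metric_space"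
  assumes Z: "ahlfors_space \<nu>Z QZ CZ" and W: "ahlfors_space \<nu>W QW CW"
    and reg: "borel_regular \<nu>Z" "borel_regular \<nu>W"
    and f: "continuous_on UNIV f"
    and le: "\<And>U. open U \<Longrightarrow> emeasure \<nu>Z (f -` U) \<le> ennreal K * emeasure \<nu>W U"
  shows "f \<in> measurable \<nu>Z \<nu>W"
    and "\<And>A. A \<in> sets \<nu>W \<Longrightarrow> emeasure \<nu>Z (f -` A) \<le> ennreal K * emeasure \<nu>W A"
proof -
  interpret Z: ahlfors_space \<nu>Z QZ CZ by fact
  interpret W: ahlfors_space \<nu>W QW CW by fact
  note Borel_le = Borel_preimage_measure_bound[OF Z W f le]
  have meas: "f \<in> measurable \<nu>Z borel"
    using borel_measurable_continuous_on[OF f Z.ident_measurable] .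
  have Borel_sets: "f -` B \<in> sets \<nu>Z" if "B \<in> sets borel" for B
    using measurable_sets[OF meas that] by simp
  have hull: "\<exists>B\<in>sets borel. A \<subseteq> B \<and> emeasure \<nu>W B = emeasure \<nu>W A" if "A \<in> sets \<nu>W" for A
    using reg(2) that by (auto simp: borel_regular_def)
  have null: "f -` A \<in> sets \<nu>Z" if "A \<in> null_sets \<nu>W" for A
  proof -
    have "A \<in> sets \<nu>W" "emeasure \<nu>W A = 0" using that by auto
    then obtain B where B: "B \<in> sets borel" "A \<subseteq> B" "emeasure \<nu>W B = 0"
      using hull by metis
    then have "f -` B \<in> null_sets \<nu>Z"
      using Borel_le[OF _ B(1)] Borel_sets by (auto simp: null_sets_def)
    moreover have "f -` A \<subseteq> f -` B" using B(2) by auto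
    ultimately show ?thesis
      using reg(1) by (auto simp: borel_regular_def)
  qed
  have finite: "f -` A \<in> sets \<nu>Z" if A: "A \<in> sets \<nu>W" "emeasure \<nu>W A < \<infinity>" for A
  proof -
    obtain B where B: "B \<in> sets borel" "A \<subseteq> B" "emeasure \<nu>W B = emeasure \<nu>W A"
      using hull[OF A(1)] by auto
    have Bm: "B \<in> sets \<nu>W" using B(1) W.borel_M by auto
    have "emeasure \<nu>W (B - A) = emeasure \<nu>W B - emeasure \<nu>W A"
      using A B Bm by (intro emeasure_Diff) auto
    also have "\<dots> = 0" using A(2) B(3) by simp
    finally have "B - A \<in> null_sets \<nu>W" using A(1) Bm by (auto simp: null_sets_def)
    then have "f -` B - f -` (B - A) \<in> sets \<nu>Z"
      using null Borel_sets[OF B(1)] by auto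
    moreover have "f -` A = f -` B - f -` (B - A)" using B(2) by auto
    ultimately show ?thesis by simp
  qed
  have sets: "f -` A \<in> sets \<nu>Z" if A: "A \<in> sets \<nu>W" for A
  proof -
    obtain a :: 'w where True by blast
    have "emeasure \<nu>W (A \<inter> ball a (real n)) < \<infinity>" for n
      using A W.ball_in_sets
      by (intro le_less_trans[OF emeasure_mono W.ball_finite[of a "real n"]]) auto
    then have "f -` (A \<inter> ball a (real n)) \<in> sets \<nu>Z" for n
      using A W.ball_in_sets by (intro finite) auto
    then have "(\<Union>n. f -` (A \<inter> ball a (real n))) \<in> sets \<nu>Z" by (intro sets.countable_UN) blast
    also have "(\<Union>n. f -` (A \<inter> ball a (real n))) = f -` A"
      using reals_Archimedean2 by auto
    finally show ?thesis .
  qed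
  show "f \<in> measurable \<nu>Z \<nu>W"
    using sets by (auto simp: measurable_def)
  show "emeasure \<nu>Z (f -` A) \<le> ennreal K * emeasure \<nu>W A" if A: "A \<in> sets \<nu>W" for A
  proof -
    obtain B where B: "B \<in> sets borel" "A \<subseteq> B" "emeasure \<nu>W B = emeasure \<nu>W A"
      using hull[OF A] by auto
    have "emeasure \<nu>Z (f -` A) \<le> emeasure \<nu>Z (f -` B)"
      using B(2) Borel_sets[OF B(1)] by (intro emeasure_mono) auto
    also have "\<dots> \<le> ennreal K * emeasure \<nu>W B"
      by (rule Borel_le[OF _ B(1)])
    finally show ?thesis using B(3) by simp
  qed
qed

text \<open>The image of \<open>M\<close> under \<open>f\<close> is a measure dominated by the multiple \<open>c\<close> of \<open>N\<close>.\<close>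

lemma nn_integral_comp_le:
  assumes f: "f \<in> measurable M N"
    and le: "\<And>A. A \<in> sets N \<Longrightarrow> emeasure M (f -` A \<inter> space M) \<le> c * emeasure N A"
    and h: "h \<in> borel_measurable N"
  shows "(\<integral>\<^sup>+x. h (f x) \<partial>M) \<le> c * (\<integral>\<^sup>+y. h y \<partial>N)"
proof -
  have "emeasure (distr M N f) A \<le> emeasure (scale_measure c N) A" for A
    using f le[of A] by (cases "A \<in> sets N") (auto simp: emeasure_distr emeasure_notin_sets)
  then have "distr M N f \<le> scale_measure c N"
    by (auto simp: le_measure_iff le_fun_def space_scale_measure)
  then have "(\<integral>\<^sup>+y. h y \<partial>distr M N f) \<le> (\<integral>\<^sup>+y. h y \<partial>scale_measure c N)"
    by (intro nn_integral_mono_measure) auto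
  then show ?thesis
    using f h by (simp add: nn_integral_distr nn_integral_scale_measure)
qed

section \<open>Besov energies\<close>

text \<open>The estimates are made for the \<open>p\<close>-th power of the seminorm, to which pairs of near and of far
  points contribute additively; the root is taken at the end.\<close>

definition besov_energy :: "'a::metric_space measure \<Rightarrow> real \<Rightarrow> real \<Rightarrow> ('a \<Rightarrow> real) \<Rightarrow> ennreal" where
  "besov_energy M s p u =
     (\<integral>\<^sup>+y. (\<integral>\<^sup>+x. ennreal (\<bar>u x - u y\<bar> powr p / dist x y powr (s * p))
                     / emeasure M (ball x (dist x y)) \<partial>M) \<partial>M)"

text \<open>The integrand of a Gagliardo seminorm. In a \<open>Q\<close>-regular space with \<open>t = s * p + Q\<close> it is
  comparable to the integrand of the Besov seminorm; in contrast to the latter, which contains the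
  measure of a ball with moving centre, it is evidently jointly measurable. The value on the diagonal
  is 0, since real powers of 0 are 0.\<close>

definition gagliardo_kernel :: "real \<Rightarrow> real \<Rightarrow> ('a::metric_space \<Rightarrow> real) \<Rightarrow> 'a \<Rightarrow> 'a \<Rightarrow> ennreal" where
  "gagliardo_kernel t p u x y = ennreal (\<bar>u x - u y\<bar> powr p * dist x y powr - t)"

definition gagliardo_energy :: "'a::metric_space measure \<Rightarrow> real \<Rightarrow> real \<Rightarrow> ('a \<Rightarrow> real) \<Rightarrow> ennreal" where
  "gagliardo_energy M t p u = (\<integral>\<^sup>+y. (\<integral>\<^sup>+x. gagliardo_kernel t p u x y \<partial>M) \<partial>M)"

context ahlfors_space
begin

lemma dist_swap_measurable: "(\<lambda>(y, x). dist x y) \<in> borel_measurable (M \<Otimes>\<^sub>M M)"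
  using dist_measurable by (simp add: case_prod_unfold dist_commute)

lemma gagliardo_kernel_measurable:
  assumes [measurable]: "u \<in> borel_measurable M"
  shows "(\<lambda>(y, x). gagliardo_kernel t p u x y) \<in> borel_measurable (M \<Otimes>\<^sub>M M)"
proof -
  note [measurable] = dist_measurable
  have "(\<lambda>p'. ennreal (\<bar>u (snd p') - u (fst p')\<bar> powr p * dist (fst p') (snd p') powr - t))
      \<in> borel_measurable (M \<Otimes>\<^sub>M M)"
    by measurable
  then show ?thesis by (simp add: gagliardo_kernel_def case_prod_unfold dist_commute)
qed

lemma gagliardo_kernel_measurable1:
  assumes "u \<in> borel_measurable M"
  shows "(\<lambda>x. gagliardo_kernel t p u x y) \<in> borel_measurable M"
  using measurable_Pair2[OF gagliardo_kernel_measurable[OF assms], of y t p] by simp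

lemma gagliardo_inner_measurable:
  assumes "u \<in> borel_measurable M"
  shows "(\<lambda>y. \<integral>\<^sup>+x. gagliardo_kernel t p u x y \<partial>M) \<in> borel_measurable M"
proof -
  interpret sigma_finite_measure M by (rule sigma_finite)
  show ?thesis
    using gagliardo_kernel_measurable[OF assms] by (rule borel_measurable_nn_integral)
qed

lemma gagliardo_energy_cmult:
  assumes "u \<in> borel_measurable M"
  shows "(\<integral>\<^sup>+y. (\<integral>\<^sup>+x. c * gagliardo_kernel t p u x y \<partial>M) \<partial>M) = c * gagliardo_energy M t p u"
  using gagliardo_kernel_measurable1[OF assms] gagliardo_inner_measurable[OF assms]
  by (simp add: gagliardo_energy_def nn_integral_cmult)

text \<open>For distinct points their distance is an admissible radius, so the measure of the ball in the
  integrand is comparable to \<open>dist x y powr Q\<close>. On the diagonal everything is 0.\<close>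

lemma besov_integrand_bounds:
  fixes u :: "'a \<Rightarrow> real" and x y :: 'a and s p :: real
  defines "F \<equiv> ennreal (\<bar>u x - u y\<bar> powr p / dist x y powr (s * p)) / emeasure M (ball x (dist x y))"
  shows "F \<le> ennreal C * gagliardo_kernel (s * p + Q) p u x y"
    and "ennreal (inverse C) * gagliardo_kernel (s * p + Q) p u x y \<le> F"
proof -
  have "F \<le> ennreal C * gagliardo_kernel (s * p + Q) p u x y \<and>
    ennreal (inverse C) * gagliardo_kernel (s * p + Q) p u x y \<le> F"
  proof (cases "x = y")
    case True
    then show ?thesis by (simp add: F_def gagliardo_kernel_def)
  next
    case False
    define d where "d = dist x y"
    have d: "0 < d" using False by (simp add: d_def)
    obtain m where m: "0 \<le> m" "emeasure M (ball x d) = ennreal m"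
      using ball_finite[of x d] by (cases "emeasure M (ball x d)" rule: ennreal_cases) auto
    have lower: "inverse C * d powr Q \<le> m"
      using ball_lower[OF d, of x] dist_less_two_ediam[OF two_points, of x y] m
      by (simp add: d_def)
    have upper: "m \<le> C * d powr Q"
      using ball_upper[OF d, of x] m C_pos by simp
    define a where "a = \<bar>u x - u y\<bar> powr p / d powr (s * p)"
    have a: "0 \<le> a" by (simp add: a_def)
    have l: "0 < inverse C * d powr Q" using C_pos d by simp
    then have "0 < m" using lower by linarith
    then have F: "F = ennreal (a / m)"
      using a m by (simp add: F_def a_def d_def divide_ennreal)
    have k: "gagliardo_kernel (s * p + Q) p u x y = ennreal (a / d powr Q)"
      using d by (simp add: gagliardo_kernel_def a_def d_def[symmetric] powr_minus powr_diff divide_inverse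
          mult.assoc)
    have "a / m \<le> a / (inverse C * d powr Q)"
      using lower l a \<open>0 < m\<close> by (intro divide_left_mono) auto
    also have "\<dots> = C * (a / d powr Q)"
      using C_pos by (simp add: field_simps)
    finally have 1: "a / m \<le> C * (a / d powr Q)" .
    have "inverse C * (a / d powr Q) = a / (C * d powr Q)"
      by (simp add: divide_inverse mult_ac)
    also have "\<dots> \<le> a / m"
      using upper a \<open>0 < m\<close> C_pos d by (intro divide_left_mono) auto
    finally have 2: "inverse C * (a / d powr Q) \<le> a / m" .
    have "ennreal C * gagliardo_kernel (s * p + Q) p u x y = ennreal (C * (a / d powr Q))"
      "ennreal (inverse C) * gagliardo_kernel (s * p + Q) p u x y = ennreal (inverse C * (a / d powr Q))"
      unfolding k by (intro ennreal_mult[symmetric]; use a C_pos in simp)+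
    with 1 2 show ?thesis by (simp only: F) (metis ennreal_leI)
  qed
  then show "F \<le> ennreal C * gagliardo_kernel (s * p + Q) p u x y"
    "ennreal (inverse C) * gagliardo_kernel (s * p + Q) p u x y \<le> F" by auto
qed

lemma besov_energy_le_gagliardo_energy:
  assumes "u \<in> borel_measurable M"
  shows "besov_energy M s p u \<le> ennreal C * gagliardo_energy M (s * p + Q) p u"
  unfolding besov_energy_def gagliardo_energy_cmult[OF assms, symmetric]
  by (intro nn_integral_mono besov_integrand_bounds)

text \<open>The constant is first moved to the side of the Gagliardo kernel, where measurability allows it to be
  taken out of the integrals; it cannot be taken out of the Besov integral directly, whose integrand
  is not known to be measurable.\<close>

lemma gagliardo_energy_le_besov_energy:
  assumes "u \<in> borel_measurable M"
  shows "gagliardo_energy M (s * p + Q) p u \<le> ennreal C * besov_energy M s p u"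
proof -
  have "ennreal C * ennreal (inverse C) = 1"
    using C_pos by (simp flip: ennreal_mult)
  then have "gagliardo_energy M (s * p + Q) p u
      = ennreal C * (ennreal (inverse C) * gagliardo_energy M (s * p + Q) p u)"
    by (simp flip: mult.assoc)
  also have "ennreal (inverse C) * gagliardo_energy M (s * p + Q) p u \<le> besov_energy M s p u"
    unfolding besov_energy_def gagliardo_energy_cmult[OF assms, symmetric]
    by (intro nn_integral_mono besov_integrand_bounds)
  finally show ?thesis by (simp add: mult_left_mono)
qed

text \<open>The summand with \<open>P y\<close> is integrated over \<open>x\<close> first, the one with \<open>P x\<close> over \<open>y\<close> first, by
  Tonelli's theorem; either way the kernel contributes at most \<open>T\<close>.\<close>

lemma far_interaction_bound:
  fixes P :: "'a \<Rightarrow> ennreal"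
  assumes P [measurable]: "P \<in> borel_measurable M"
    and k: "\<And>y. (\<integral>\<^sup>+x. k (dist x y) \<partial>M) \<le> T" and k_meas [measurable]: "k \<in> borel_measurable borel"
  shows "(\<integral>\<^sup>+y. (\<integral>\<^sup>+x. (P x + P y) * k (dist x y) \<partial>M) \<partial>M) \<le> 2 * (T * (\<integral>\<^sup>+x. P x \<partial>M))"
proof -
  interpret sigma_finite_measure M by (rule sigma_finite)
  interpret pair_sigma_finite M M by unfold_locales
  have [measurable]: "(\<lambda>(y, x). k (dist x y)) \<in> borel_measurable (M \<Otimes>\<^sub>M M)"
    using measurable_compose[OF dist_swap_measurable k_meas] by (simp add: case_prod_unfold)
  have [measurable]: "(\<lambda>x. k (dist x y)) \<in> borel_measurable M" for y
    using measurable_Pair2[of "\<lambda>(y, x). k (dist x y)" M M borel y] by simp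
  have inner [measurable]: "(\<lambda>y. \<integral>\<^sup>+x. k (dist x y) \<partial>M) \<in> borel_measurable M"
    by measurable
  have J: "(\<integral>\<^sup>+y. P y * (\<integral>\<^sup>+x. k (dist x y) \<partial>M) \<partial>M) \<le> T * (\<integral>\<^sup>+x. P x \<partial>M)"
  proof -
    have "(\<integral>\<^sup>+y. P y * (\<integral>\<^sup>+x. k (dist x y) \<partial>M) \<partial>M) \<le> (\<integral>\<^sup>+y. T * P y \<partial>M)"
      using k by (intro nn_integral_mono) (simp add: mult.commute[of T] mult_left_mono)
    also have "\<dots> = T * (\<integral>\<^sup>+x. P x \<partial>M)" by (simp add: nn_integral_cmult)
    finally show ?thesis .
  qed
  have meas1: "(\<lambda>(y, x). P x * k (dist x y)) \<in> borel_measurable (M \<Otimes>\<^sub>M M)"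
    by measurable
  have meas2: "(\<lambda>y. \<integral>\<^sup>+x. P x * k (dist x y) \<partial>M) \<in> borel_measurable M"
    by measurable
  have "(\<integral>\<^sup>+y. (\<integral>\<^sup>+x. (P x + P y) * k (dist x y) \<partial>M) \<partial>M)
      = (\<integral>\<^sup>+y. (\<integral>\<^sup>+x. P x * k (dist x y) \<partial>M) + P y * (\<integral>\<^sup>+x. k (dist x y) \<partial>M) \<partial>M)"
    by (simp add: distrib_right nn_integral_add nn_integral_cmult)
  also have "\<dots> = (\<integral>\<^sup>+y. (\<integral>\<^sup>+x. P x * k (dist x y) \<partial>M) \<partial>M)
      + (\<integral>\<^sup>+y. P y * (\<integral>\<^sup>+x. k (dist x y) \<partial>M) \<partial>M)"
    using meas2 by (intro nn_integral_add) measurable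
  also have "(\<integral>\<^sup>+y. (\<integral>\<^sup>+x. P x * k (dist x y) \<partial>M) \<partial>M)
      = (\<integral>\<^sup>+x. (\<integral>\<^sup>+y. P x * k (dist x y) \<partial>M) \<partial>M)"
    using Fubini'[OF meas1] by simp
  also have "\<dots> = (\<integral>\<^sup>+x. P x * (\<integral>\<^sup>+y. k (dist y x) \<partial>M) \<partial>M)"
    by (simp add: nn_integral_cmult dist_commute)
  finally show ?thesis
    using add_mono[OF J J] by (simp add: mult_2)
qed

end

lemma gagliardo_energy_comp_le:
  fixes f :: "'z::metric_space \<Rightarrow> 'w::metric_space"
  assumes W: "ahlfors_space \<nu>W QW CW" and u: "u \<in> borel_measurable \<nu>W"
    and f: "\<And>h. h \<in> borel_measurable \<nu>W \<Longrightarrow> (\<integral>\<^sup>+x. h (f x) \<partial>\<nu>Z) \<le> c * (\<integral>\<^sup>+y. h y \<partial>\<nu>W)"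
  shows "(\<integral>\<^sup>+y. (\<integral>\<^sup>+x. gagliardo_kernel t p u (f x) (f y) \<partial>\<nu>Z) \<partial>\<nu>Z) \<le> c * (c * gagliardo_energy \<nu>W t p u)"
proof -
  interpret W: ahlfors_space \<nu>W QW CW by fact
  note [measurable] = W.gagliardo_inner_measurable[OF u]
  have "(\<integral>\<^sup>+y. (\<integral>\<^sup>+x. gagliardo_kernel t p u (f x) (f y) \<partial>\<nu>Z) \<partial>\<nu>Z)
      \<le> (\<integral>\<^sup>+y. c * (\<integral>\<^sup>+w. gagliardo_kernel t p u w (f y) \<partial>\<nu>W) \<partial>\<nu>Z)"
    by (intro nn_integral_mono f W.gagliardo_kernel_measurable1 u)
  also have "\<dots> \<le> c * (\<integral>\<^sup>+v. c * (\<integral>\<^sup>+w. gagliardo_kernel t p u w v \<partial>\<nu>W) \<partial>\<nu>W)"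
    by (intro f) measurable
  also have "\<dots> = c * (c * gagliardo_energy \<nu>W t p u)"
    by (simp add: gagliardo_energy_def nn_integral_cmult W.gagliardo_inner_measurable[OF u])
  finally show ?thesis .
qed

lemma abs_diff_powr_le:
  fixes a b :: real
  assumes "0 \<le> p"
  shows "\<bar>a - b\<bar> powr p \<le> 2 powr p * (\<bar>a\<bar> powr p + \<bar>b\<bar> powr p)"
proof -
  have "\<bar>a - b\<bar> powr p \<le> (2 * max \<bar>a\<bar> \<bar>b\<bar>) powr p"
    using assms by (intro powr_mono2) auto
  also have "\<dots> = 2 powr p * max \<bar>a\<bar> \<bar>b\<bar> powr p"
    by (simp add: powr_mult)
  also have "max \<bar>a\<bar> \<bar>b\<bar> powr p \<le> \<bar>a\<bar> powr p + \<bar>b\<bar> powr p"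
    by (simp add: max_def)
  finally show ?thesis by simp
qed

section \<open>The composition operator\<close>

text \<open>For points of distance less than \<open>r\<close>, the upper Hoelder bound turns the power of the distance in
  the domain into a power of the distance in the target. Both exponents can be matched because
  \<open>dist x y powr (\<theta> * tW - tZ)\<close> is bounded by the same power of \<open>r\<close>. For the other points the
  difference is estimated by the sum of the absolute values.\<close>

lemma gagliardo_kernel_comp_le:
  fixes f :: "'z::metric_space \<Rightarrow> 'w::metric_space"
  assumes p: "0 \<le> p" and r: "0 < r" and L: "1 \<le> L" and \<theta>: "0 < \<theta>"
    and t: "0 \<le> tZ" "0 \<le> tW" "tZ \<le> \<theta> * tW"
    and inj: "inj f" and upper: "\<And>x y. dist x y < r \<Longrightarrow> dist (f x) (f y) \<le> L * dist x y powr \<theta>"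
  shows "gagliardo_kernel tZ p (u \<circ> f) x y
    \<le> ennreal (r powr (\<theta> * tW - tZ) * L powr tW) * gagliardo_kernel tW p u (f x) (f y)
      + ennreal (2 powr p) * ((ennreal (\<bar>u (f x)\<bar> powr p) + ennreal (\<bar>u (f y)\<bar> powr p))
          * ennreal (indicator {r..} (dist x y) * dist x y powr - tZ))"
proof (cases "x = y")
  case True
  then show ?thesis by (simp add: gagliardo_kernel_def)
next
  case False
  let ?d = "dist x y" and ?e = "dist (f x) (f y)" and ?a = "\<bar>u (f x) - u (f y)\<bar> powr p"
  have d: "0 < ?d" "0 < ?e" using False inj by (auto dest: injD)
  show ?thesis
  proof (cases "?d < r")
    case True
    have "?d powr - tZ = ?d powr (\<theta> * tW - tZ) * ?d powr (- (\<theta> * tW))"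
      by (simp flip: powr_add)
    also have "\<dots> \<le> r powr (\<theta> * tW - tZ) * ?d powr (- (\<theta> * tW))"
      using True t d by (intro mult_right_mono powr_mono2) auto
    also have "?d powr (- (\<theta> * tW)) = (?d powr \<theta>) powr - tW"
      by (simp add: powr_powr)
    also have "\<dots> \<le> (?e / L) powr - tW"
      using upper[OF True] d L t
      by (intro powr_mono2') (auto simp: field_simps)
    also have "\<dots> = L powr tW * ?e powr - tW"
      using d L by (simp add: powr_divide powr_minus field_simps)
    finally have "?d powr - tZ \<le> r powr (\<theta> * tW - tZ) * (L powr tW * ?e powr - tW)"
      using r by (simp add: mult_left_mono)
    then have "?a * ?d powr - tZ \<le> ?a * (r powr (\<theta> * tW - tZ) * (L powr tW * ?e powr - tW))"
      by (intro mult_left_mono) auto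
    then have "gagliardo_kernel tZ p (u \<circ> f) x y
      \<le> ennreal (r powr (\<theta> * tW - tZ) * L powr tW) * gagliardo_kernel tW p u (f x) (f y)"
      unfolding gagliardo_kernel_def by (simp flip: ennreal_mult add: mult_ac ennreal_leI)
    then show ?thesis by (rule order_trans) simp
  next
    case False
    have "?a * ?d powr - tZ
        \<le> 2 powr p * (\<bar>u (f x)\<bar> powr p + \<bar>u (f y)\<bar> powr p) * ?d powr - tZ"
      using abs_diff_powr_le[OF p] by (intro mult_right_mono) auto
    then have "gagliardo_kernel tZ p (u \<circ> f) x y
      \<le> ennreal (2 powr p) * ((ennreal (\<bar>u (f x)\<bar> powr p) + ennreal (\<bar>u (f y)\<bar> powr p))
          * ennreal (indicator {r..} (dist x y) * dist x y powr - tZ))"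
      using False unfolding gagliardo_kernel_def
      by (simp flip: ennreal_mult ennreal_plus add: mult_ac ennreal_leI)
    then show ?thesis by (rule order_trans) simp
  qed
qed

text \<open>The near part is transported by \<open>f\<close> once in each variable, which costs the factor \<open>K\<close> twice; the
  far part is controlled by the norm in \<open>L\<^sup>p\<close>, because the kernel truncated at distance \<open>r\<close> has
  bounded integrals.\<close>

lemma besov_energy_comp_bound:
  fixes f :: "'z::metric_space \<Rightarrow> 'w::metric_space"
  assumes Z: "ahlfors_space \<nu>Z QZ CZ" and W: "ahlfors_space \<nu>W QW CW"
    and f_meas: "f \<in> measurable \<nu>Z \<nu>W" and K: "0 \<le> K"
    and f_le: "\<And>h. h \<in> borel_measurable \<nu>W \<Longrightarrow>
      (\<integral>\<^sup>+x. h (f x) \<partial>\<nu>Z) \<le> ennreal K * (\<integral>\<^sup>+y. h y \<partial>\<nu>W)"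
    and p: "1 \<le> p" and s: "0 < s" "0 < s'" and r: "0 < r" and L: "1 \<le> L" and \<theta>: "0 < \<theta>"
    and exponents: "s' * p + QZ \<le> \<theta> * (s * p + QW)"
    and inj: "inj f" and upper: "\<And>x y. dist x y < r \<Longrightarrow> dist (f x) (f y) \<le> L * dist x y powr \<theta>"
  obtains A where "0 \<le> A" "\<And>u. u \<in> borel_measurable \<nu>W \<Longrightarrow>
      besov_energy \<nu>Z s' p (u \<circ> f)
        \<le> ennreal A * ((\<integral>\<^sup>+w. ennreal (\<bar>u w\<bar> powr p) \<partial>\<nu>W) + besov_energy \<nu>W s p u)"
proof -
  interpret Z: ahlfors_space \<nu>Z QZ CZ by fact
  interpret W: ahlfors_space \<nu>W QW CW by fact
  define tZ where "tZ = s' * p + QZ"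
  define tW where "tW = s * p + QW"
  have t: "0 \<le> tZ" "0 \<le> tW" "tZ \<le> \<theta> * tW"
    using p s Z.Q_pos W.Q_pos exponents by (auto simp: tZ_def tW_def)
  define k where "k d = ennreal (indicator {r..} d * d powr - tZ)" for d
  have k_meas [measurable]: "k \<in> borel_measurable borel"
    unfolding k_def by measurable
  obtain T where T: "0 \<le> T" "\<And>y. (\<integral>\<^sup>+x. k (dist x y) \<partial>\<nu>Z) \<le> ennreal T"
    using Z.tail_bound[of "s' * p" r] s p r unfolding k_def tZ_def
    by (metis mult_pos_pos less_le_trans zero_less_one)
  define a1 where "a1 = r powr (\<theta> * tW - tZ) * L powr tW"
  define A1 where "A1 = CZ * a1 * K * K * CW"
  define A2 where "A2 = CZ * 2 powr p * 2 * T * K"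
  have pos: "0 \<le> CZ" "0 \<le> CW" "0 \<le> a1" "0 \<le> A1" "0 \<le> A2"
    using Z.C_pos W.C_pos T(1) K by (auto simp: a1_def A1_def A2_def)
  have "besov_energy \<nu>Z s' p (u \<circ> f)
      \<le> ennreal (A1 + A2) * ((\<integral>\<^sup>+w. ennreal (\<bar>u w\<bar> powr p) \<partial>\<nu>W) + besov_energy \<nu>W s p u)"
    if u: "u \<in> borel_measurable \<nu>W" for u
  proof -
    note [measurable] = u f_meas
    have v: "u \<circ> f \<in> borel_measurable \<nu>Z" by measurable
    define P where "P x = ennreal (\<bar>u (f x)\<bar> powr p)" for x
    have P [measurable]: "P \<in> borel_measurable \<nu>Z" unfolding P_def by measurable
    define X where "X = (\<integral>\<^sup>+w. ennreal (\<bar>u w\<bar> powr p) \<partial>\<nu>W)"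
    define Y where "Y = besov_energy \<nu>W s p u"
    define I where "I x y = gagliardo_kernel tW p u (f x) (f y)" for x y
    define J where "J x y = (P x + P y) * k (dist x y)" for x y
    have P_le: "(\<integral>\<^sup>+x. P x \<partial>\<nu>Z) \<le> ennreal K * X"
      unfolding P_def X_def by (rule f_le) measurable
    have I_meas: "(\<lambda>(y, x). I x y) \<in> borel_measurable (\<nu>Z \<Otimes>\<^sub>M \<nu>Z)"
    proof -
      have "(\<lambda>q. (f (fst q), f (snd q))) \<in> measurable (\<nu>Z \<Otimes>\<^sub>M \<nu>Z) (\<nu>W \<Otimes>\<^sub>M \<nu>W)" by measurable
      from measurable_compose[OF this W.gagliardo_kernel_measurable[OF u]]
      show ?thesis by (simp add: I_def case_prod_unfold)
    qed
    have J_meas: "(\<lambda>(y, x). J x y) \<in> borel_measurable (\<nu>Z \<Otimes>\<^sub>M \<nu>Z)"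
    proof -
      have [measurable]: "(\<lambda>(y, x). k (dist x y)) \<in> borel_measurable (\<nu>Z \<Otimes>\<^sub>M \<nu>Z)"
        using measurable_compose[OF Z.dist_swap_measurable k_meas] by (simp add: case_prod_unfold)
      show ?thesis unfolding J_def by measurable
    qed
    have I1: "(\<lambda>x. I x y) \<in> borel_measurable \<nu>Z" and J1: "(\<lambda>x. J x y) \<in> borel_measurable \<nu>Z" for y
      using measurable_Pair2[OF I_meas, of y] measurable_Pair2[OF J_meas, of y] by simp_all
    have I2: "(\<lambda>y. \<integral>\<^sup>+x. I x y \<partial>\<nu>Z) \<in> borel_measurable \<nu>Z"
      and J2: "(\<lambda>y. \<integral>\<^sup>+x. J x y \<partial>\<nu>Z) \<in> borel_measurable \<nu>Z"
      using sigma_finite_measure.borel_measurable_nn_integral[OF Z.sigma_finite I_meas]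
        sigma_finite_measure.borel_measurable_nn_integral[OF Z.sigma_finite J_meas] by auto
    have "gagliardo_energy \<nu>Z tZ p (u \<circ> f)
        \<le> (\<integral>\<^sup>+y. (\<integral>\<^sup>+x. ennreal a1 * I x y + ennreal (2 powr p) * J x y \<partial>\<nu>Z) \<partial>\<nu>Z)"
      unfolding gagliardo_energy_def I_def J_def P_def k_def a1_def
      using p r L \<theta> t inj upper by (intro nn_integral_mono gagliardo_kernel_comp_le) auto
    also have "\<dots> = ennreal a1 * (\<integral>\<^sup>+y. (\<integral>\<^sup>+x. I x y \<partial>\<nu>Z) \<partial>\<nu>Z)
        + ennreal (2 powr p) * (\<integral>\<^sup>+y. (\<integral>\<^sup>+x. J x y \<partial>\<nu>Z) \<partial>\<nu>Z)"
      using I1 I2 J1 J2 by (simp add: nn_integral_add nn_integral_cmult)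
    also have "\<dots> \<le> ennreal a1 * (ennreal K * (ennreal K * (ennreal CW * Y)))
        + ennreal (2 powr p) * (2 * (ennreal T * (ennreal K * X)))"
    proof (intro add_mono mult_left_mono)
      have "(\<integral>\<^sup>+y. (\<integral>\<^sup>+x. I x y \<partial>\<nu>Z) \<partial>\<nu>Z) \<le> ennreal K * (ennreal K * gagliardo_energy \<nu>W tW p u)"
        unfolding I_def by (rule gagliardo_energy_comp_le[OF W u f_le])
      also have "\<dots> \<le> ennreal K * (ennreal K * (ennreal CW * Y))"
        unfolding Y_def tW_def by (intro mult_left_mono W.gagliardo_energy_le_besov_energy u) auto
      finally show "(\<integral>\<^sup>+y. (\<integral>\<^sup>+x. I x y \<partial>\<nu>Z) \<partial>\<nu>Z) \<le> ennreal K * (ennreal K * (ennreal CW * Y))" .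
      have "(\<integral>\<^sup>+y. (\<integral>\<^sup>+x. J x y \<partial>\<nu>Z) \<partial>\<nu>Z) \<le> 2 * (ennreal T * (\<integral>\<^sup>+x. P x \<partial>\<nu>Z))"
        unfolding J_def using P T(2) k_meas by (rule Z.far_interaction_bound)
      also have "\<dots> \<le> 2 * (ennreal T * (ennreal K * X))"
        using P_le by (intro mult_left_mono) auto
      finally show "(\<integral>\<^sup>+y. (\<integral>\<^sup>+x. J x y \<partial>\<nu>Z) \<partial>\<nu>Z) \<le> 2 * (ennreal T * (ennreal K * X))" .
    qed auto
    finally have gagliardo: "gagliardo_energy \<nu>Z tZ p (u \<circ> f)
      \<le> ennreal a1 * (ennreal K * (ennreal K * (ennreal CW * Y)))
        + ennreal (2 powr p) * (2 * (ennreal T * (ennreal K * X)))" .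
    have "besov_energy \<nu>Z s' p (u \<circ> f) \<le> ennreal CZ * gagliardo_energy \<nu>Z tZ p (u \<circ> f)"
      unfolding tZ_def by (rule Z.besov_energy_le_gagliardo_energy[OF v])
    also have "\<dots> \<le> ennreal CZ * (ennreal a1 * (ennreal K * (ennreal K * (ennreal CW * Y)))
        + ennreal (2 powr p) * (2 * (ennreal T * (ennreal K * X))))"
      by (intro mult_left_mono gagliardo) auto
    also have "\<dots> = ennreal A1 * Y + ennreal A2 * X"
    proof -
      have "ennreal A1 = ennreal CZ * (ennreal a1 * (ennreal K * (ennreal K * ennreal CW)))"
        using pos K by (simp add: A1_def ennreal_mult mult_ac)
      moreover have "ennreal A2 = ennreal CZ * (ennreal (2 powr p) * (2 * (ennreal T * ennreal K)))"
        using pos K T(1) by (simp add: A2_def ennreal_mult mult_ac)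
      ultimately show ?thesis by (simp add: distrib_left mult_ac)
    qed
    also have "\<dots> \<le> ennreal (A1 + A2) * Y + ennreal (A1 + A2) * X"
      using pos by (intro add_mono mult_right_mono ennreal_leI) auto
    also have "\<dots> = ennreal (A1 + A2) * (X + Y)" by (simp add: distrib_left add.commute)
    finally show ?thesis unfolding X_def Y_def .
  qed
  with pos that[of "A1 + A2"] show thesis by auto
qed

lemma epowr_mono:
  assumes "0 \<le> a" "x \<le> y"
  shows "epowr x a \<le> epowr y a"
proof (cases "y = \<infinity>")
  case True
  then show ?thesis by (simp add: epowr_def)
next
  case False
  with assms(2) have "x \<noteq> \<infinity>" by (auto simp: top_unique)
  with False assms show ?thesis
    by (auto simp: epowr_def less_top intro!: ennreal_leI powr_mono2 enn2real_mono)
qed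

text \<open>Both sides are compared with the power of the larger of \<open>x\<close> and \<open>y\<close>. Adding 1 keeps the
  constant positive, so that its product with \<open>\<infinity>\<close> is \<open>\<infinity>\<close>.\<close>

lemma epowr_cmult_add_le:
  assumes a: "0 < a" and A: "0 \<le> A"
  shows "epowr (ennreal A * (x + y)) a \<le> ennreal ((2 * A + 1) powr a) * (epowr x a + epowr y a)"
proof (cases "x = \<infinity> \<or> y = \<infinity>")
  case True
  then have top: "epowr x a + epowr y a = \<infinity>" by (auto simp: epowr_def)
  have "0 < (2 * A + 1) powr a" using A by simp
  then show ?thesis unfolding top by (simp add: ennreal_mult_top)
next
  case False
  then obtain b c where bc: "0 \<le> b" "x = ennreal b" "0 \<le> c" "y = ennreal c"
    by (cases x rule: ennreal_cases; cases y rule: ennreal_cases) auto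
  have "(A * (b + c)) powr a \<le> ((2 * A + 1) * max b c) powr a"
  proof (intro powr_mono2)
    have "A * (b + c) \<le> A * (2 * max b c)" using A by (intro mult_left_mono) auto
    also have "\<dots> \<le> (2 * A + 1) * max b c" using bc by (simp add: algebra_simps)
    finally show "A * (b + c) \<le> (2 * A + 1) * max b c" .
  qed (use a A bc in auto)
  also have "\<dots> = (2 * A + 1) powr a * max b c powr a"
    using A bc by (simp add: powr_mult)
  also have "\<dots> \<le> (2 * A + 1) powr a * (b powr a + c powr a)"
    by (intro mult_left_mono) (auto simp: max_def)
  finally have "(A * (b + c)) powr a \<le> (2 * A + 1) powr a * (b powr a + c powr a)" .
  moreover have "epowr (ennreal A * (x + y)) a = ennreal ((A * (b + c)) powr a)"
    using A bc by (simp add: epowr_def flip: ennreal_plus ennreal_mult)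
  moreover have "epowr x a + epowr y a = ennreal (b powr a + c powr a)"
    using bc by (simp add: epowr_def)
  moreover have "ennreal ((2 * A + 1) powr a) * ennreal (b powr a + c powr a)
      = ennreal ((2 * A + 1) powr a * (b powr a + c powr a))"
    by (intro ennreal_mult[symmetric]) auto
  ultimately show ?thesis by (simp only: ennreal_leI)
qed

theorem theorem1p3:
  fixes \<nu>Z :: "'z::metric_space measure" and \<nu>W :: "'w::metric_space measure"
    and f :: "'z \<Rightarrow> 'w"
    and QZ QW \<theta>1 \<theta>2 s s' p r :: real
  assumes "\<exists>x y :: 'z. x \<noteq> y" and "\<exists>x y :: 'w. x \<noteq> y"
    and "borel_regular \<nu>Z" and "borel_regular \<nu>W"
    and "QZ > 0" and "QW > 0"
    and "ahlfors_regular \<nu>Z QZ" and "ahlfors_regular \<nu>W QW"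
    and "\<theta>1 > 0" and "\<theta>2 > 0" and "s > 0" and "s' > 0" and "p \<ge> 1"
    and "QZ \<ge> \<theta>1 * QW"
    and "s' \<le> \<theta>2 * s + (\<theta>2 * QW - QZ) / p"
    and "0 < r" and "ennreal r < 2 * ediam (UNIV :: 'z set)"
    and "locally_biHolder \<theta>1 \<theta>2 r f"
  shows "(\<forall>u\<in>besov_space \<nu>W s p. u \<circ> f \<in> besov_space \<nu>Z s' p) \<and>
    (\<forall>u\<in>besov_space \<nu>W s p. \<forall>v\<in>besov_space \<nu>W s p.
       (AE w in \<nu>W. u w = v w) \<longrightarrow> (AE z in \<nu>Z. (u \<circ> f) z = (v \<circ> f) z)) \<and>
    (\<exists>C::real. \<forall>u\<in>besov_space \<nu>W s p.
       besov_norm \<nu>Z s' p (u \<circ> f) \<le> ennreal C * besov_norm \<nu>W s p u)"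
proof -
  obtain CZ where Z: "ahlfors_space \<nu>Z QZ CZ"
    using ahlfors_regular_imp_ahlfors_space assms(1,3,5,7) by metis
  obtain CW where W: "ahlfors_space \<nu>W QW CW"
    using ahlfors_regular_imp_ahlfors_space assms(2,4,6,8) by metis
  interpret Z: ahlfors_space \<nu>Z QZ CZ by fact
  interpret W: ahlfors_space \<nu>W QW CW by fact
  obtain g L where hom: "homeomorphism UNIV UNIV f g" and L: "1 \<le> L"
    and lower: "\<And>x y. dist x y < r \<Longrightarrow> inverse L * dist x y powr \<theta>1 \<le> dist (f x) (f y)"
    and upper: "\<And>x y. dist x y < r \<Longrightarrow> dist (f x) (f y) \<le> L * dist x y powr \<theta>2"
    using assms(18) unfolding locally_biHolder_def by metis
  have f_cont: "continuous_on UNIV f" using hom by (simp add: homeomorphism_def)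
  have inj: "inj f" using hom by (metis UNIV_I homeomorphism_def injI)
  obtain K where K: "0 < K" "\<And>U. open U \<Longrightarrow> emeasure \<nu>Z (f -` U) \<le> ennreal K * emeasure \<nu>W U"
    using open_preimage_measure_bound[OF Z W hom assms(9,14,16) L lower] by metis
  note f_meas = preimage_measure_bound(1)[OF Z W assms(3,4) f_cont K(2)]
  note f_le = preimage_measure_bound(2)[OF Z W assms(3,4) f_cont K(2)]
  have f_int: "(\<integral>\<^sup>+x. h (f x) \<partial>\<nu>Z) \<le> ennreal K * (\<integral>\<^sup>+y. h y \<partial>\<nu>W)"
    if "h \<in> borel_measurable \<nu>W" for h
    using nn_integral_comp_le[OF f_meas _ that] f_le by simp
  \<comment> \<open>The hypothesis on \<open>s'\<close>, multiplied by \<open>p\<close>, compares the exponents of the two Gagliardo kernels.\<close>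
  have "p * s' \<le> p * (\<theta>2 * s + (\<theta>2 * QW - QZ) / p)"
    using assms(13,15) by (intro mult_left_mono) auto
  also have "\<dots> = \<theta>2 * (s * p + QW) - QZ"
    using assms(13) by (simp add: distrib_left mult_ac)
  finally have "s' * p + QZ \<le> \<theta>2 * (s * p + QW)"
    by (simp add: mult.commute)
  then obtain A where A: "0 \<le> A" "\<And>u. u \<in> borel_measurable \<nu>W \<Longrightarrow>
      besov_energy \<nu>Z s' p (u \<circ> f)
        \<le> ennreal A * ((\<integral>\<^sup>+w. ennreal (\<bar>u w\<bar> powr p) \<partial>\<nu>W) + besov_energy \<nu>W s p u)"
    using besov_energy_comp_bound[OF Z W f_meas less_imp_le[OF K(1)] f_int assms(13,11,12,16) L
        assms(10) _ inj upper] by metis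
  have p: "0 < 1 / p" using assms(13) by simp
  define c1 where "c1 = (2 * K + 1) powr (1 / p)"
  define c2 where "c2 = (2 * A + 1) powr (1 / p)"
  have c: "0 \<le> c1" "0 \<le> c2" by (simp_all add: c1_def c2_def)
  have Lp: "Lp_norm \<nu>Z p (u \<circ> f) \<le> ennreal c1 * Lp_norm \<nu>W p u" if [measurable]: "u \<in> borel_measurable \<nu>W" for u
  proof -
    have "(\<integral>\<^sup>+x. ennreal (\<bar>(u \<circ> f) x\<bar> powr p) \<partial>\<nu>Z)
        \<le> ennreal K * (\<integral>\<^sup>+w. ennreal (\<bar>u w\<bar> powr p) \<partial>\<nu>W)"
      using f_int[of "\<lambda>w. ennreal (\<bar>u w\<bar> powr p)"] by simp
    then have "Lp_norm \<nu>Z p (u \<circ> f)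
        \<le> epowr (ennreal K * ((\<integral>\<^sup>+w. ennreal (\<bar>u w\<bar> powr p) \<partial>\<nu>W) + 0)) (1 / p)"
      unfolding Lp_norm_def using p by (intro epowr_mono) auto
    also have "\<dots> \<le> ennreal c1 * (Lp_norm \<nu>W p u + epowr 0 (1 / p))"
      unfolding Lp_norm_def c1_def using p K(1) by (intro epowr_cmult_add_le) auto
    finally show ?thesis by (simp add: epowr_def)
  qed
  have semi: "besov_seminorm \<nu>Z s' p (u \<circ> f) \<le> ennreal c2 * besov_norm \<nu>W s p u"
    if u: "u \<in> borel_measurable \<nu>W" for u
  proof -
    have "besov_seminorm \<nu>Z s' p (u \<circ> f) = epowr (besov_energy \<nu>Z s' p (u \<circ> f)) (1 / p)"
      by (simp only: besov_seminorm_def besov_energy_def)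
    also have "\<dots> \<le> epowr (ennreal A * ((\<integral>\<^sup>+w. ennreal (\<bar>u w\<bar> powr p) \<partial>\<nu>W) + besov_energy \<nu>W s p u)) (1 / p)"
      using p by (intro epowr_mono A(2) u) auto
    also have "\<dots> \<le> ennreal c2 * (Lp_norm \<nu>W p u + epowr (besov_energy \<nu>W s p u) (1 / p))"
      unfolding Lp_norm_def c2_def using p A(1) by (intro epowr_cmult_add_le)
    also have "\<dots> = ennreal c2 * besov_norm \<nu>W s p u"
      by (simp only: besov_norm_def besov_seminorm_def besov_energy_def)
    finally show ?thesis .
  qed
  have norm: "besov_norm \<nu>Z s' p (u \<circ> f) \<le> ennreal (c1 + c2) * besov_norm \<nu>W s p u"
    if u: "u \<in> borel_measurable \<nu>W" for u
  proof -
    have "Lp_norm \<nu>Z p (u \<circ> f) \<le> ennreal c1 * besov_norm \<nu>W s p u"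
      by (rule order_trans[OF Lp[OF u]]) (auto simp: besov_norm_def intro!: mult_left_mono)
    then have "besov_norm \<nu>Z s' p (u \<circ> f)
        \<le> ennreal c1 * besov_norm \<nu>W s p u + ennreal c2 * besov_norm \<nu>W s p u"
      unfolding besov_norm_def[of \<nu>Z] using semi[OF u] by (intro add_mono)
    then show ?thesis using c by (simp add: distrib_right)
  qed
  show ?thesis
  proof (intro conjI ballI impI)
    fix u assume "u \<in> besov_space \<nu>W s p"
    then have u: "u \<in> borel_measurable \<nu>W" and fin: "besov_norm \<nu>W s p u < \<infinity>"
      by (auto simp: besov_space_def)
    have "besov_norm \<nu>Z s' p (u \<circ> f) < \<infinity>"
      using fin by (intro le_less_trans[OF norm[OF u]]) (simp add: ennreal_mult_less_top)
    moreover have "Lp_norm \<nu>Z p (u \<circ> f) \<le> besov_norm \<nu>Z s' p (u \<circ> f)"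
      by (simp add: besov_norm_def)
    moreover have "u \<circ> f \<in> borel_measurable \<nu>Z"
      using f_meas u by (rule measurable_comp)
    ultimately show "u \<circ> f \<in> besov_space \<nu>Z s' p"
      by (auto simp: besov_space_def intro: le_less_trans)
  next
    fix u v assume "AE w in \<nu>W. u w = v w"
    then obtain N where N: "N \<in> null_sets \<nu>W" "{w. u w \<noteq> v w} \<subseteq> N"
      by (auto simp: eventually_ae_filter)
    then have "f -` N \<in> null_sets \<nu>Z"
      using f_le[of N] measurable_sets[OF f_meas, of N] by (auto simp: null_sets_def)
    then show "AE z in \<nu>Z. (u \<circ> f) z = (v \<circ> f) z"
      by (rule AE_I') (use N(2) in auto)
  next
    show "\<exists>C::real. \<forall>u\<in>besov_space \<nu>W s p.
       besov_norm \<nu>Z s' p (u \<circ> f) \<le> ennreal C * besov_norm \<nu>W s p u"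
      using norm by (intro exI[of _ "c1 + c2"]) (auto simp: besov_space_def)
  qed
qed

end
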